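(* Let $\mathfrak{D}$ be an exponential deriver. Then $\mathsf{MP}^{\mathsf{exp}}_{\mathsf{unary}}(\mathfrak{D})$ is in NP.
   Context: A logic $\mathcal{L}=(S_{\mathcal{L}},\models)$ consists of a set $S_{\mathcal{L}}$ of sentences, each with a size $|\alpha|$, and a model-based consequence relation. A hypergraph is $H=(V,E,\ell)$ with finite vertex set $V$, hyperedges $(S,d)$ with $S\subseteq V$, $d\in V$, and labelling $\ell:V\to S_{\mathcal{L}}$; its size is $|H|=\sum_{(S,d)\in E}(|\ell(d)|+\sum_{v\in S}|\ell(v)|)$. A leaf is a vertex with no incoming hyperedge; a sink is a vertex occurring in no premise set $S$ of a hyperedge. A derivation structure over a finite theory $\mathcal{T}$ is a hypergraph whose leaves are labelled by elements of $\mathcal{T}$ and with $\{\ell(s)\mid s\in S\}\models\ell(d)$ for each hyperedge $(S,d)$. A path is a sequence $d_0,(S_1,d_1),d_1,\dots,(S_q,d_q),d_q$ with $q\ge1$ and $d_{j-1}\in S_j$; a cycle is a path with $d_0=d_q$. A proof for $\mathcal{T}\models\eta$ is an acyclic derivation structure over $\mathcal{T}$ with exactly one sink, labelled $\eta$. A homomorphism between hypergraphs maps vertices to vertices, preserving labels and mapping each hyperedge $(S,d)$ to the hyperedge $(h(S),h(d))$. A deriver $\mathfrak{D}$ consists of $C_{\mathcal{L}}\subseteq S_{\mathcal{L}}$ and a function mapping each finite theory $\mathcal{T}$ and $\eta\in C_{\mathcal{L}}$ to a derivation structure $\mathfrak{D}(\mathcal{T},\eta)$ over $\mathcal{T}$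 such that $\mathcal{T}\models\eta$ iff $\mathfrak{D}(\mathcal{T},\eta)$ contains a proof for $\mathcal{T}\models\eta$. It is exponential if for some polynomial $p$, $|\mathfrak{D}(\mathcal{T},\eta)|\le 2^{p(|\mathcal{T}|+|\eta|)}$. A proof $P$ is admissible w.r.t. $\mathfrak{D}(\mathcal{T},\eta)$ if there is a homomorphism $P\to\mathfrak{D}(\mathcal{T},\eta)$; $\mathrm{ct}(P)$ is the number of vertices of $P$. $\mathsf{MP}^{\mathsf{exp}}_{\mathsf{unary}}(\mathfrak{D})$ is the problem: given a finite theory $\mathcal{T}$, $\eta\in C_{\mathcal{L}}$ and $n\in\mathbb{N}$ encoded in unary, decide whether there is a proof $P$ for $\mathcal{T}\models\eta$ admissible w.r.t. $\mathfrak{D}(\mathcal{T},\eta)$ with $\mathrm{ct}(P)\le n$. The derivation structure $\mathfrak{D}(\mathcal{T},\eta)$ is accessed only as follows: its vertices are numbered $v_1,\dots,v_m$ (indices of polynomial size in binary), and there are unit-cost oracle functions deciding, for given vertices $v_1,\dots,v_l$, whether $(\{v_1,\dots,v_{l-1}\},v_l)$ is a hyperedge, and, for a vertex $v$ and a sentence $\alpha$, whether $\ell(v)=\alpha$. *)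

theory Defs
  imports "HOL-Computational_Algebra.Polynomial"
begin

section \<open>Logics and hypergraphs\<close>

text \<open>Interpretations are the elements of the type \<open>'m\<close>.\<close>

record ('m, 'a) logic =
  sentences :: "'a set"
  satisfies :: "'m \<Rightarrow> 'a \<Rightarrow> bool"
  sent_size :: "'a \<Rightarrow> nat"

definition entails :: "('m, 'a) logic \<Rightarrow> 'a set \<Rightarrow> 'a \<Rightarrow> bool" where
  "entails L T \<eta> \<longleftrightarrow> (\<forall>I. (\<forall>\<alpha>\<in>T. satisfies L I \<alpha>) \<longrightarrow> satisfies L I \<eta>)"

definition finite_theory :: "('m, 'a) logic \<Rightarrow> 'a set \<Rightarrow> bool" where
  "finite_theory L T \<longleftrightarrow> finite T \<and> T \<subseteq> sentences L"

definition theory_size :: "('m, 'a) logic \<Rightarrow> 'a set \<Rightarrow> nat" where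
  "theory_size L T = (\<Sum>\<alpha>\<in>T. sent_size L \<alpha>)"

record ('v, 'a) hypergraph =
  verts :: "'v set"
  hedges :: "('v set \<times> 'v) set"
  lab :: "'v \<Rightarrow> 'a"

definition hypergraph :: "('m, 'a) logic \<Rightarrow> ('v, 'a) hypergraph \<Rightarrow> bool" where
  "hypergraph L H \<longleftrightarrow> finite (verts H) \<and>
     (\<forall>(S, d)\<in>hedges H. S \<subseteq> verts H \<and> d \<in> verts H) \<and>
     (\<forall>v\<in>verts H. lab H v \<in> sentences L)"

definition hypergraph_size :: "('m, 'a) logic \<Rightarrow> ('v, 'a) hypergraph \<Rightarrow> nat" where
  "hypergraph_size L H =
     (\<Sum>(S, d)\<in>hedges H. sent_size L (lab H d) + (\<Sum>v\<in>S. sent_size L (lab H v)))"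

definition leaves :: "('v, 'a) hypergraph \<Rightarrow> 'v set" where
  "leaves H = {v \<in> verts H. \<not> (\<exists>S. (S, v) \<in> hedges H)}"

definition sinks :: "('v, 'a) hypergraph \<Rightarrow> 'v set" where
  "sinks H = {v \<in> verts H. \<not> (\<exists>S d. (S, d) \<in> hedges H \<and> v \<in> S)}"

text \<open>\<open>hwalk H d\<^sub>0 [(S\<^sub>1, d\<^sub>1), \<dots>, (S\<^sub>q, d\<^sub>q)] d\<^sub>q\<close> says that
  \<open>d\<^sub>0, (S\<^sub>1, d\<^sub>1), d\<^sub>1, \<dots>, (S\<^sub>q, d\<^sub>q), d\<^sub>q\<close> is a path, except that \<open>q = 0\<close> is allowed.\<close>

fun hwalk :: "('v, 'a) hypergraph \<Rightarrow> 'v \<Rightarrow> ('v set \<times> 'v) list \<Rightarrow> 'v \<Rightarrow> bool" where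
  "hwalk H u [] v \<longleftrightarrow> u = v"
| "hwalk H u ((S, d) # es) v \<longleftrightarrow> (S, d) \<in> hedges H \<and> u \<in> S \<and> hwalk H d es v"

definition acyclic_hypergraph :: "('v, 'a) hypergraph \<Rightarrow> bool" where
  "acyclic_hypergraph H \<longleftrightarrow> \<not> (\<exists>v es. es \<noteq> [] \<and> hwalk H v es v)"

definition derivation_structure ::
    "('m, 'a) logic \<Rightarrow> 'a set \<Rightarrow> ('v, 'a) hypergraph \<Rightarrow> bool" where
  "derivation_structure L T H \<longleftrightarrow> hypergraph L H \<and>
     (\<forall>v\<in>leaves H. lab H v \<in> T) \<and>
     (\<forall>(S, d)\<in>hedges H. entails L (lab H ` S) (lab H d))"

definition proof_for ::
    "('m, 'a) logic \<Rightarrow> 'a set \<Rightarrow> 'a \<Rightarrow> ('v, 'a) hypergraph \<Rightarrow> bool" where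
  "proof_for L T \<eta> P \<longleftrightarrow> derivation_structure L T P \<and> acyclic_hypergraph P \<and>
     (\<exists>v. sinks P = {v} \<and> lab P v = \<eta>)"

definition subhypergraph :: "('v, 'a) hypergraph \<Rightarrow> ('v, 'a) hypergraph \<Rightarrow> bool" where
  "subhypergraph P H \<longleftrightarrow> verts P \<subseteq> verts H \<and> hedges P \<subseteq> hedges H \<and>
     (\<forall>v\<in>verts P. lab P v = lab H v)"

definition homomorphism ::
    "('u, 'a) hypergraph \<Rightarrow> ('v, 'a) hypergraph \<Rightarrow> ('u \<Rightarrow> 'v) \<Rightarrow> bool" where
  "homomorphism G H h \<longleftrightarrow> h ` verts G \<subseteq> verts H \<and>
     (\<forall>v\<in>verts G. lab H (h v) = lab G v) \<and>
     (\<forall>(S, d)\<in>hedges G. (h ` S, h d) \<in> hedges H)"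

definition ct :: "('v, 'a) hypergraph \<Rightarrow> nat" where
  "ct P = card (verts P)"


section \<open>Derivers\<close>

record ('v, 'a) deriver =
  targets :: "'a set"
  derive_for :: "'a set \<Rightarrow> 'a \<Rightarrow> ('v, 'a) hypergraph"

definition deriver :: "('m, 'a) logic \<Rightarrow> ('v, 'a) deriver \<Rightarrow> bool" where
  "deriver L D \<longleftrightarrow> targets D \<subseteq> sentences L \<and>
     (\<forall>T \<eta>. finite_theory L T \<longrightarrow> \<eta> \<in> targets D \<longrightarrow>
        derivation_structure L T (derive_for D T \<eta>) \<and>
        (entails L T \<eta> \<longleftrightarrow> (\<exists>P. subhypergraph P (derive_for D T \<eta>) \<and> proof_for L T \<eta> P)))"

definition exponential_deriver :: "('m, 'a) logic \<Rightarrow> ('v, 'a) deriver \<Rightarrow> bool" where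
  "exponential_deriver L D \<longleftrightarrow> deriver L D \<and>
     (\<exists>p :: nat poly. \<forall>T \<eta>. finite_theory L T \<longrightarrow> \<eta> \<in> targets D \<longrightarrow>
        hypergraph_size L (derive_for D T \<eta>) \<le> 2 ^ poly p (theory_size L T + sent_size L \<eta>))"

definition admissible ::
    "('v, 'a) deriver \<Rightarrow> 'a set \<Rightarrow> 'a \<Rightarrow> ('u, 'a) hypergraph \<Rightarrow> bool" where
  "admissible D T \<eta> P \<longleftrightarrow> (\<exists>h. homomorphism P (derive_for D T \<eta>) h)"


section \<open>Polynomial-time machines with oracles and NP\<close>

text \<open>
  The machine model is a multi-tape machine in which each tape is used as a stack
  (a two-way tape is a pair of stacks), with a finite control written as a structured program.
  Every elementary step inspects or changes one symbol at the top of one stack, so this model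
  and multi-tape Turing machines simulate each other with polynomial overhead.
  \<open>None\<close> plays the role of the blank: it is what is read on an empty stack.
  \<open>Ask\<close> passes the entire contents of a stack to one of the oracles and branches on the answer, at
  cost one.
\<close>

datatype symbol = Bit bool | Sep

type_synonym word = "symbol list"

type_synonym store = "nat \<Rightarrow> word"

datatype 'q com =
    Push nat symbol
  | Pop nat
  | Seq "'q com" "'q com"
  | Cond nat "symbol option set" "'q com" "'q com"
  | While nat "symbol option set" "'q com"
  | Ask 'q nat "'q com" "'q com"

definition top_of :: "word \<Rightarrow> symbol option" where
  "top_of w = (case w of [] \<Rightarrow> None | a # _ \<Rightarrow> Some a)"

text \<open>\<open>exec Q c s t s'\<close>: with oracles \<open>Q\<close>, the program \<open>c\<close> started in \<open>s\<close> terminates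
  after \<open>t\<close> steps in \<open>s'\<close>.\<close>

inductive exec :: "('q \<Rightarrow> word \<Rightarrow> bool) \<Rightarrow> 'q com \<Rightarrow> store \<Rightarrow> nat \<Rightarrow> store \<Rightarrow> bool"
  for Q where
  Push: "exec Q (Push r a) s 1 (s(r := a # s r))"
| Pop: "exec Q (Pop r) s 1 (s(r := tl (s r)))"
| Seq: "exec Q c1 s t1 s1 \<Longrightarrow> exec Q c2 s1 t2 s2 \<Longrightarrow> exec Q (Seq c1 c2) s (t1 + t2) s2"
| CondTrue: "top_of (s r) \<in> A \<Longrightarrow> exec Q c1 s t s' \<Longrightarrow> exec Q (Cond r A c1 c2) s (t + 1) s'"
| CondFalse: "top_of (s r) \<notin> A \<Longrightarrow> exec Q c2 s t s' \<Longrightarrow> exec Q (Cond r A c1 c2) s (t + 1) s'"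
| WhileFalse: "top_of (s r) \<notin> A \<Longrightarrow> exec Q (While r A c) s 1 s"
| WhileTrue: "top_of (s r) \<in> A \<Longrightarrow> exec Q c s t1 s1 \<Longrightarrow> exec Q (While r A c) s1 t2 s2 \<Longrightarrow>
    exec Q (While r A c) s (t1 + t2 + 1) s2"
| AskTrue: "Q q (s r) \<Longrightarrow> exec Q c1 s t s' \<Longrightarrow> exec Q (Ask q r c1 c2) s (t + 1) s'"
| AskFalse: "\<not> Q q (s r) \<Longrightarrow> exec Q c2 s t s' \<Longrightarrow> exec Q (Ask q r c1 c2) s (t + 1) s'"

inductive_cases exec_PushE: "exec Q (Push r a) s t s'"
inductive_cases exec_PopE: "exec Q (Pop r) s t s'"
inductive_cases exec_SeqE: "exec Q (Seq c1 c2) s t s'"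
inductive_cases exec_CondE: "exec Q (Cond r A c1 c2) s t s'"
inductive_cases exec_WhileE: "exec Q (While r A c) s t s'"
inductive_cases exec_AskE: "exec Q (Ask q r c1 c2) s t s'"

lemma exec_deterministic:
  "exec Q c s t s' \<Longrightarrow> exec Q c s u s'' \<Longrightarrow> u = t \<and> s'' = s'"
proof (induction arbitrary: u s'' rule: exec.induct)
  case (Push r a s)
  then show ?case by (auto elim: exec_PushE)
next
  case (Pop r s)
  then show ?case by (auto elim: exec_PopE)
next
  case (Seq c1 s t1 s1 c2 t2 s2)
  from Seq.prems obtain u1 v u2 where "exec Q c1 s u1 v" "exec Q c2 v u2 s''" "u = u1 + u2"
    by (rule exec_SeqE)
  with Seq.IH show ?case by metis
next
  case (CondTrue s r A c1 t s' c2)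
  from CondTrue.prems CondTrue.hyps obtain u1 where "exec Q c1 s u1 s''" "u = u1 + 1"
    by (elim exec_CondE) simp_all
  with CondTrue.IH show ?case by metis
next
  case (CondFalse s r A c2 t s' c1)
  from CondFalse.prems CondFalse.hyps obtain u1 where "exec Q c2 s u1 s''" "u = u1 + 1"
    by (elim exec_CondE) simp_all
  with CondFalse.IH show ?case by metis
next
  case (WhileFalse s r A c)
  from WhileFalse.prems show ?case by (rule exec_WhileE) (use WhileFalse.hyps in simp_all)
next
  case (WhileTrue s r A c t1 s1 t2 s2)
  from WhileTrue.prems obtain u1 v u2
    where "exec Q c s u1 v" "exec Q (While r A c) v u2 s''" "u = u1 + u2 + 1"
    by (rule exec_WhileE) (use WhileTrue.hyps in simp_all)
  with WhileTrue.IH show ?case by metis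
next
  case (AskTrue q s r c1 t s' c2)
  from AskTrue.prems AskTrue.hyps obtain u1 where "exec Q c1 s u1 s''" "u = u1 + 1"
    by (elim exec_AskE) simp_all
  with AskTrue.IH show ?case by metis
next
  case (AskFalse q s r c2 t s' c1)
  from AskFalse.prems AskFalse.hyps obtain u1 where "exec Q c2 s u1 s''" "u = u1 + 1"
    by (elim exec_AskE) simp_all
  with AskFalse.IH show ?case by metis
qed

text \<open>Stack 0 holds the input, stack 1 the certificate.\<close>

definition initial :: "word \<Rightarrow> word \<Rightarrow> store" where
  "initial w y = (\<lambda>_. [])(0 := w, 1 := y)"

definition accepting :: "store \<Rightarrow> bool" where
  "accepting s \<longleftrightarrow> top_of (s 0) = Some (Bit True)"

text \<open>
  A decision problem is given by its instances, its yes-instances, the words that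
  represent an instance (a finite set can be listed in several orders), and the oracles
  available on an instance. Only words representing instances are considered as input.
\<close>

record ('i, 'q) problem =
  instances :: "'i set"
  holds :: "'i \<Rightarrow> bool"
  codes :: "'i \<Rightarrow> word set"
  oracles :: "'i \<Rightarrow> 'q \<Rightarrow> word \<Rightarrow> bool"

text \<open>
  The program \<open>c\<close> is a verifier: on input \<open>w\<close> it halts within \<open>poly p (length w)\<close> steps on
  every certificate of length at most \<open>poly q (length w)\<close>, and it accepts one of them exactly
  when \<open>w\<close> represents a yes-instance.
\<close>

definition in_NP :: "('i, 'q) problem \<Rightarrow> bool" where
  "in_NP \<Pi> \<longleftrightarrow> (\<exists>(c :: 'q com) (p :: nat poly) (q :: nat poly).
     \<forall>x\<in>instances \<Pi>. \<forall>w\<in>codes \<Pi> x.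
       (\<forall>y. length y \<le> poly q (length w) \<longrightarrow>
          (\<exists>t s. exec (oracles \<Pi> x) c (initial w y) t s \<and> t \<le> poly p (length w))) \<and>
       (holds \<Pi> x \<longleftrightarrow>
          (\<exists>y t s. length y \<le> poly q (length w) \<and>
             exec (oracles \<Pi> x) c (initial w y) t s \<and> accepting s)))"


section \<open>The minimal proof problem\<close>

text \<open>Sentences are written as bit strings whose length is polynomially related to the size.\<close>

definition sentence_encoding :: "('m, 'a) logic \<Rightarrow> ('a \<Rightarrow> bool list) \<Rightarrow> bool" where
  "sentence_encoding L enc \<longleftrightarrow> inj_on enc (sentences L) \<and>
     (\<exists>p :: nat poly. \<forall>\<alpha>\<in>sentences L.
        length (enc \<alpha>) \<le> poly p (sent_size L \<alpha>) \<and> sent_size L \<alpha> \<le> poly p (length (enc \<alpha>)))"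

text \<open>Binary representation, least significant bit first, without leading zeros.\<close>

fun binary :: "nat \<Rightarrow> bool list" where
  "binary n = (if n = 0 then [] else odd n # binary (n div 2))"

declare binary.simps [simp del]

definition vertex_numbering ::
    "('m, 'a) logic \<Rightarrow> ('v, 'a) deriver \<Rightarrow> ('a set \<Rightarrow> 'a \<Rightarrow> nat \<Rightarrow> 'v) \<Rightarrow> bool" where
  "vertex_numbering L D \<nu> \<longleftrightarrow>
     (\<forall>T \<eta>. finite_theory L T \<longrightarrow> \<eta> \<in> targets D \<longrightarrow>
        bij_betw (\<nu> T \<eta>) {1..card (verts (derive_for D T \<eta>))} (verts (derive_for D T \<eta>))) \<and>
     (\<exists>p :: nat poly. \<forall>T \<eta>. finite_theory L T \<longrightarrow> \<eta> \<in> targets D \<longrightarrow>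
        length (binary (card (verts (derive_for D T \<eta>)))) \<le> poly p (theory_size L T + sent_size L \<eta>))"

datatype access = Is_Hyperedge | Has_Label

text \<open>A hyperedge query is \<open>i\<^sub>1 Sep \<dots> i\<^sub>l Sep\<close>, a label query is \<open>i Sep \<alpha>\<close>, with binary vertex
  indices. Words not of this form, or with an index out of range, are answered negatively.\<close>

fun access_answer ::
    "('m, 'a) logic \<Rightarrow> ('a \<Rightarrow> bool list) \<Rightarrow> ('v, 'a) hypergraph \<Rightarrow> (nat \<Rightarrow> 'v) \<Rightarrow>
     access \<Rightarrow> word \<Rightarrow> bool" where
  "access_answer L enc H \<nu> Is_Hyperedge w \<longleftrightarrow>
     (\<exists>is i. w = concat (map (\<lambda>j. map Bit (binary j) @ [Sep]) (is @ [i])) \<and>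
        set (is @ [i]) \<subseteq> {1..card (verts H)} \<and> (\<nu> ` set is, \<nu> i) \<in> hedges H)"
| "access_answer L enc H \<nu> Has_Label w \<longleftrightarrow>
     (\<exists>i\<in>{1..card (verts H)}. \<exists>\<alpha>\<in>sentences L.
        w = map Bit (binary i) @ [Sep] @ map Bit (enc \<alpha>) \<and> lab H (\<nu> i) = \<alpha>)"

text \<open>An instance is coded as \<open>n Sep \<eta> Sep \<alpha>\<^sub>1 Sep \<dots> \<alpha>\<^sub>k Sep\<close>, with \<open>n\<close> in unary and the
  theory listed without repetitions in any order.\<close>

definition instance_codes :: "('a \<Rightarrow> bool list) \<Rightarrow> 'a set \<times> 'a \<times> nat \<Rightarrow> word set" where
  "instance_codes enc = (\<lambda>(T, \<eta>, n).
     {replicate n (Bit True) @ [Sep] @ map Bit (enc \<eta>) @ [Sep] @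
        concat (map (\<lambda>\<alpha>. map Bit (enc \<alpha>) @ [Sep]) ts) | ts. set ts = T \<and> distinct ts})"

text \<open>Proofs are finite, so up to isomorphism their vertices are natural numbers.\<close>

definition MP_exp_unary ::
    "('m, 'a) logic \<Rightarrow> ('a \<Rightarrow> bool list) \<Rightarrow> ('v, 'a) deriver \<Rightarrow>
     ('a set \<Rightarrow> 'a \<Rightarrow> nat \<Rightarrow> 'v) \<Rightarrow> ('a set \<times> 'a \<times> nat, access) problem" where
  "MP_exp_unary L enc D \<nu> =
     \<lparr>instances = {(T, \<eta>, n). finite_theory L T \<and> \<eta> \<in> targets D},
      holds = (\<lambda>(T, \<eta>, n). \<exists>P :: (nat, 'a) hypergraph.
         proof_for L T \<eta> P \<and> admissible D T \<eta> P \<and> ct P \<le> n),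
      codes = instance_codes enc,
      oracles = (\<lambda>(T, \<eta>, n). access_answer L enc (derive_for D T \<eta>) (\<nu> T \<eta>))\<rparr>"

end

theory Submission
  imports Defs
begin

text \<open>
  A proof with at most \<open>n\<close> vertices that is admissible w.r.t. \<open>D(T, \<eta>)\<close> exists iff there is a set of
  at most \<open>n\<close> vertices of \<open>D(T, \<eta>)\<close>, one of them labelled \<open>\<eta>\<close>, with a rank function such that
  every vertex of the set is labelled by an axiom or is the conclusion of a hyperedge whose premises
  lie in the set and have smaller rank. Given such a set, choosing one hyperedge per vertex and keeping
  the part needed to reach the goal yields a proof.
  A certificate lists these vertices, first those labelled by axioms in the order of the theory, then
  the others by increasing rank. With each vertex it tells which of the earlier vertices are its
  premises, so the verifier can compose the oracle query without comparing indices and never looks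
  at the exponentially large structure.

  The certificate is written as a sequence of instructions for a small word machine. A failing query
  simply adds no vertex, hence soundness is an invariant of the single instructions, and the
  running time is polynomial because each instruction consumes part of the certificate.
\<close>

section \<open>Stack programs\<close>

text \<open>The unary coding of \<open>n\<close> is what keeps certificates short: at most
  \<open>n\<close> vertices are listed, and each costs its own index plus a walk over at most
  \<open>n\<close> earlier ones, which is polynomial in the input length. The obstacle is that the
  machine has neither random access nor a comparison of words. So a certificate never writes out
  premises: they are copied from the list of derived vertices, and membership in that list needs no
  test. The theory can be passed only once, which is why axiom-labelled vertices follow its order,
  and the goal vertex is presented by moving the zipper until it lies on top. Every word decodes to
  some instruction sequence, so no certificate is malformed. Halting and soundness hold for all
  certificates and come from one induction; completeness builds a certificate from its last
  instruction to its first.\<close>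

abbreviation head_word :: "word \<Rightarrow> word" where
  "head_word w \<equiv> takeWhile (\<lambda>x. x \<noteq> Sep) w"

abbreviation rest_words :: "word \<Rightarrow> word" where
  "rest_words w \<equiv> tl (dropWhile (\<lambda>x. x \<noteq> Sep) w)"

text \<open>The layout shared by the theory in an instance code and by the indices of a hyperedge
  query. Each word is closed by its own \<open>Sep\<close>, so parsing is unique
  (\<open>blocks_inj\<close>).\<close>

definition blocks :: "bool list list \<Rightarrow> word" where
  "blocks bs = concat (map (\<lambda>b. map Bit b @ [Sep]) bs)"

lemma blocks_Nil [simp]: "blocks [] = []"
  by (simp add: blocks_def)

lemma blocks_Cons [simp]: "blocks (b # bs) = map Bit b @ Sep # blocks bs"
  by (simp add: blocks_def)

lemma blocks_append: "blocks (bs @ bs') = blocks bs @ blocks bs'"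
  by (simp add: blocks_def)

lemma head_word_Bit [simp]: "head_word (map Bit b @ Sep # w) = map Bit b"
  by (induction b) auto

lemma dropWhile_Bit [simp]: "dropWhile (\<lambda>x. x \<noteq> Sep) (map Bit b @ Sep # w) = Sep # w"
  by (induction b) auto

lemma head_word_Bit_rev [simp]: "head_word (rev (map Bit b) @ Sep # w) = rev (map Bit b)"
  by (metis head_word_Bit rev_map)

lemma dropWhile_Bit_rev [simp]: "dropWhile (\<lambda>x. x \<noteq> Sep) (rev (map Bit b) @ Sep # w) = Sep # w"
  by (metis dropWhile_Bit rev_map)

lemma head_word_only_Bit [simp]: "head_word (map Bit b) = map Bit b"
  by (induction b) auto

lemma dropWhile_only_Bit [simp]: "dropWhile (\<lambda>x. x \<noteq> Sep) (map Bit b) = []"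
  by (induction b) auto

lemma bits_Sep_eq_iff:
  "map Bit b @ Sep # w = map Bit b' @ Sep # w' \<longleftrightarrow> b = b' \<and> w = w'"
proof
  assume eq: "map Bit b @ Sep # w = map Bit b' @ Sep # w'"
  have "map Bit b = map Bit b'"
    using arg_cong[OF eq, of head_word] by simp
  moreover have "inj Bit"
    by (simp add: inj_def)
  ultimately have "b = b'"
    by (simp add: inj_map_eq_map)
  with eq show "b = b' \<and> w = w'"
    by simp
qed simp

lemma head_word_is_bits: "\<exists>b. head_word w = map Bit b"
proof (induction w)
  case (Cons x w)
  then obtain b where "head_word w = map Bit b"
    by blast
  then show ?case
    by (cases x) (auto intro: exI[of _ "_ # b"])
qed auto

lemma blocks_inj: "blocks bs = blocks bs' \<Longrightarrow> bs = bs'"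
proof (induction bs arbitrary: bs')
  case Nil
  then show ?case
    by (cases bs') auto
next
  case (Cons b bs)
  then show ?case
    by (cases bs') (auto simp: bits_Sep_eq_iff)
qed

lemma length_rest_words: "length (rest_words w) \<le> length w - length (head_word w) - 1"
proof -
  have "length (head_word w) + length (dropWhile (\<lambda>x. x \<noteq> Sep) w) = length w"
    by (metis length_append takeWhile_dropWhile_id)
  then show ?thesis
    by simp
qed

lemma length_head_word: "length (head_word w) \<le> length w"
  by (rule length_takeWhile_le)

lemma length_head_rest: "length (head_word w) + length (rest_words w) \<le> length w"
  using length_rest_words[of w] length_head_word[of w] by (auto simp del: length_tl)

section \<open>Moving words between stacks\<close>

definition skip :: "'q com" where
  "skip = While 0 {} (Pop 0)"

text \<open>The continuation \<open>c\<close> is an argument, since there is no empty command to end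
  a sequence with.\<close>

definition push_each :: "symbol \<Rightarrow> nat list \<Rightarrow> 'q com \<Rightarrow> 'q com" where
  "push_each x bs c = foldr (\<lambda>b. Seq (Push b x)) bs c"

definition clear :: "nat \<Rightarrow> 'q com" where
  "clear a = While a (- {None}) (Pop a)"

text \<open>A symbol can be carried only in the finite control, hence one copy of the body per bit.
  The loop stops at a \<open>Sep\<close> as well as at the bottom of the stack, and the bits arrive
  on every target in reverse order.\<close>

definition move_bits :: "nat \<Rightarrow> nat list \<Rightarrow> 'q com" where
  "move_bits a bs = While a {Some (Bit True), Some (Bit False)}
     (Cond a {Some (Bit True)}
       (push_each (Bit True) bs (Pop a))
       (push_each (Bit False) bs (Pop a)))"

text \<open>The \<open>Sep\<close> is pushed first because the reversed word lands on top of it; the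
  \<open>Sep\<close> that closed the word on \<open>a\<close> is then discarded. From an empty stack
  this moves the empty word.\<close>

definition move_word :: "nat \<Rightarrow> nat list \<Rightarrow> 'q com" where
  "move_word a bs = push_each Sep bs (Seq (move_bits a bs) (Pop a))"

lemma exec_skip: "exec Q skip s 1 s"
  unfolding skip_def by (rule WhileFalse) simp

lemma exec_push_each:
  assumes "exec Q c (\<lambda>r. if r \<in> set bs then x # s r else s r) t s'" and "distinct bs"
  shows "exec Q (push_each x bs c) s (length bs + t) s'"
  using assms
proof (induction bs arbitrary: s)
  case Nil
  then show ?case
    by (simp add: push_each_def)
next
  case (Cons b bs)
  let ?s = "s(b := x # s b)"
  have "(\<lambda>r. if r \<in> set (b # bs) then x # s r else s r) =
      (\<lambda>r. if r \<in> set bs then x # ?s r else ?s r)"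
    using Cons.prems(2) by (auto simp: fun_eq_iff)
  then have "exec Q (push_each x bs c) ?s (length bs + t) s'"
    using Cons by simp
  from Seq[OF Push this] show ?case
    by (simp add: push_each_def)
qed

lemma exec_clear: "exec Q (clear a) s (2 * length (s a) + 1) (s(a := []))"
proof (induction "length (s a)" arbitrary: s)
  case 0
  then have "s(a := []) = s" "top_of (s a) \<notin> - {None}"
    by (auto simp: top_of_def)
  with 0 WhileFalse[of s a "- {None}" Q "Pop a"] show ?case
    by (simp add: clear_def)
next
  case (Suc k)
  let ?s = "s(a := tl (s a))"
  have "k = length (?s a)"
    using Suc(2) by simp
  from Suc(1)[of ?s, OF this] have "exec Q (clear a) ?s (2 * length (?s a) + 1) (?s(a := []))" .
  moreover have "top_of (s a) \<in> - {None}"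
    using Suc(2) by (auto simp: top_of_def split: list.split)
  ultimately have "exec Q (clear a) s (1 + (2 * length (?s a) + 1) + 1) (?s(a := []))"
    unfolding clear_def by (rule_tac WhileTrue[OF _ Pop])
  moreover have "1 + (2 * length (?s a) + 1) + 1 = 2 * length (s a) + 1"
    using Suc(2) by (cases "s a") auto
  ultimately show ?case
    by simp
qed

text \<open>Each bit costs a loop test, a branch, one push per target and a pop, hence the factor
  \<open>length bs + 3\<close>; the last 1 is the failing loop test.\<close>

lemma exec_move_bits:
  assumes "a \<notin> set bs" and "distinct bs"
  shows "exec Q (move_bits a bs) s (length (head_word (s a)) * (length bs + 3) + 1)
    (\<lambda>r. if r = a then dropWhile (\<lambda>x. x \<noteq> Sep) (s a)
          else if r \<in> set bs then rev (head_word (s a)) @ s r else s r)"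
    (is "exec Q _ s (?t s) (?f s)")
proof (induction "length (head_word (s a))" arbitrary: s)
  case 0
  then have "s a = [] \<or> (\<exists>w. s a = Sep # w)"
    by (cases "s a") (auto split: if_splits)
  then have top: "top_of (s a) \<notin> {Some (Bit True), Some (Bit False)}" and "?f s = s"
    by (auto simp: top_of_def fun_eq_iff split: list.splits)
  then show ?case
    using WhileFalse[of s a, OF top] 0 by (simp add: move_bits_def)
next
  case (Suc k)
  then obtain b w where sa: "s a = Bit b # w"
    by (cases "s a"; cases "hd (s a)") (auto split: if_splits)
  define s1 where "s1 = (\<lambda>r. if r \<in> set bs then Bit b # s r else s r)"
  define s2 where "s2 = s1(a := tl (s1 a))"
  have s2a: "s2 a = w"
    using assms by (simp add: s2_def s1_def sa)
  have "exec Q (push_each (Bit b) bs (Pop a)) s (length bs + 1) s2"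
    by (rule exec_push_each[OF _ assms(2)]) (simp only: s2_def s1_def[symmetric] Pop)
  moreover have "top_of (s a) = Some (Bit b)"
    by (simp add: top_of_def sa)
  ultimately have body: "exec Q (Cond a {Some (Bit True)} (push_each (Bit True) bs (Pop a))
      (push_each (Bit False) bs (Pop a))) s (length bs + 1 + 1) s2"
    by (cases b) (simp_all only: CondTrue CondFalse insert_iff empty_iff
        option.inject symbol.inject simp_thms bool_simps)
  have "k = length (head_word (s2 a))"
    using Suc(2) by (simp add: s2a sa)
  from Suc(1)[of s2, OF this] have "exec Q (move_bits a bs) s2 (?t s2) (?f s2)" .
  moreover have "top_of (s a) \<in> {Some (Bit True), Some (Bit False)}"
    by (cases b) (simp_all add: top_of_def sa)
  ultimately have "exec Q (move_bits a bs) s (length bs + 1 + 1 + ?t s2 + 1) (?f s2)"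
    using body unfolding move_bits_def by (rule_tac WhileTrue)
  moreover have "?f s2 = ?f s"
    using assms by (auto simp: s2a sa fun_eq_iff s2_def s1_def)
  moreover have "length bs + 1 + 1 + ?t s2 + 1 = ?t s"
    by (simp add: s2a sa)
  ultimately show ?case
    by metis
qed

lemma exec_move_word:
  assumes "a \<notin> set bs" and "distinct bs"
  shows "exec Q (move_word a bs) s
    (length bs + (length (head_word (s a)) * (length bs + 3) + 1 + 1))
    (\<lambda>r. if r = a then rest_words (s a)
          else if r \<in> set bs then rev (head_word (s a)) @ Sep # s r else s r)"
proof -
  define s1 where "s1 = (\<lambda>r. if r \<in> set bs then Sep # s r else s r)"
  let ?f = "\<lambda>r. if r = a then dropWhile (\<lambda>x. x \<noteq> Sep) (s1 a)
          else if r \<in> set bs then rev (head_word (s1 a)) @ s1 r else s1 r"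
  have s1a: "s1 a = s a"
    using assms by (simp add: s1_def)
  have "?f(a := tl (?f a)) = (\<lambda>r. if r = a then rest_words (s a)
          else if r \<in> set bs then rev (head_word (s a)) @ Sep # s r else s r)"
    unfolding s1a using assms by (auto simp: s1_def fun_eq_iff)
  with Seq[OF exec_move_bits[OF assms, of Q s1] Pop[of Q a ?f]]
  have "exec Q (Seq (move_bits a bs) (Pop a)) s1
      (length (head_word (s a)) * (length bs + 3) + 1 + 1)
      (\<lambda>r. if r = a then rest_words (s a)
          else if r \<in> set bs then rev (head_word (s a)) @ Sep # s r else s r)"
    unfolding s1a by simp
  then show ?thesis
    unfolding move_word_def by (intro exec_push_each[OF _ assms(2)]) (simp only: s1_def)
qed

section \<open>Grounded sets of vertices\<close>

text \<open>Indices stand in for vertices because stacks and oracles only know indices. Without the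
  rank, vertices could justify each other in a circle.\<close>

definition grounded :: "'a set \<Rightarrow> ('v, 'a) hypergraph \<Rightarrow> (nat \<Rightarrow> 'v) \<Rightarrow> nat set \<Rightarrow> bool" where
  "grounded T H \<nu> X \<longleftrightarrow> X \<subseteq> {1..card (verts H)} \<and>
     (\<exists>r :: nat \<Rightarrow> nat. \<forall>i\<in>X. lab H (\<nu> i) \<in> T \<or>
        (\<exists>S\<subseteq>X. (\<nu> ` S, \<nu> i) \<in> hedges H \<and> (\<forall>j\<in>S. r j < r i)))"

lemma grounded_finite: "grounded T H \<nu> X \<Longrightarrow> finite X"
  unfolding grounded_def using finite_subset by blast

lemma grounded_empty: "grounded T H \<nu> {}"
  by (simp add: grounded_def)

text \<open>A new vertex can be ranked above all old ones, which are its only premises. If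
  \<open>i\<close> is already in \<open>X\<close>, its old rank is kept, since other vertices may
  depend on it.\<close>

lemma grounded_insert:
  assumes X: "grounded T H \<nu> X" and i: "i \<in> {1..card (verts H)}"
    and just: "lab H (\<nu> i) \<in> T \<or> (\<exists>S\<subseteq>X. (\<nu> ` S, \<nu> i) \<in> hedges H)"
  shows "grounded T H \<nu> (insert i X)"
proof (cases "i \<in> X")
  case True
  with X show ?thesis
    by (simp add: insert_absorb)
next
  case False
  obtain r :: "nat \<Rightarrow> nat" where r: "\<forall>k\<in>X. lab H (\<nu> k) \<in> T \<or>
      (\<exists>S\<subseteq>X. (\<nu> ` S, \<nu> k) \<in> hedges H \<and> (\<forall>j\<in>S. r j < r k))"
    using X by (auto simp: grounded_def)
  \<comment> \<open>A sum of natural numbers bounds each summand, so its successor exceeds every old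
    rank.\<close>
  define r' where "r' = r(i := Suc (\<Sum>j\<in>X. r j))"
  have same: "r' j = r j" if "j \<in> X" for j
    using that False by (auto simp: r'_def)
  have less: "r' j < r' i" if "j \<in> X" for j
    using that False member_le_sum[of j X r] grounded_finite[OF X]
    by (auto simp: r'_def less_Suc_eq_le)
  have "lab H (\<nu> k) \<in> T \<or>
      (\<exists>S\<subseteq>insert i X. (\<nu> ` S, \<nu> k) \<in> hedges H \<and> (\<forall>j\<in>S. r' j < r' k))"
    if "k \<in> insert i X" for k
  proof (cases "k = i")
    case True
    with just less show ?thesis
      by (meson subset_iff subset_insertI2)
  next
    case False
    with that r same show ?thesis
      by (smt (verit) insertE subset_iff subset_insertI2)
  qed
  with X i show ?thesis
    unfolding grounded_def by blast
qed

section \<open>Acyclicity and rank functions\<close>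

lemma hwalk_rank_less:
  assumes "\<And>S d u. (S, d) \<in> hedges H \<Longrightarrow> u \<in> S \<Longrightarrow> r u < (r d :: nat)"
  shows "hwalk H u es v \<Longrightarrow> es \<noteq> [] \<Longrightarrow> r u < r v"
proof (induction es arbitrary: u)
  case (Cons e es)
  obtain S d where "e = (S, d)"
    by (cases e)
  with Cons.prems have "r u < r d" and walk: "hwalk H d es v"
    using assms by auto
  then show ?case
    using Cons.IH[OF walk] walk by (cases "es = []") auto
qed simp

text \<open>The rank of a vertex is its number of strict ancestors. Ancestors of a premise are
  ancestors of the conclusion, and the premise itself is an additional one, because by acyclicity it
  is not its own ancestor.\<close>

lemma acyclic_hypergraph_rank:
  assumes fin: "finite (verts H)" and sub: "\<And>S d. (S, d) \<in> hedges H \<Longrightarrow> S \<subseteq> verts H \<and> d \<in> verts H"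
    and acyc: "acyclic_hypergraph H"
  obtains r :: "'v \<Rightarrow> nat"
  where "\<And>S d u. (S, d) \<in> hedges H \<Longrightarrow> u \<in> S \<Longrightarrow> r u < r d"
\<comment> \<open>The rank stays schematic until the last \<open>show\<close> supplies it.\<close>
proof
  define R where "R = {(u, d). \<exists>S. (S, d) \<in> hedges H \<and> u \<in> S}"
  have walk: "\<exists>es. es \<noteq> [] \<and> hwalk H u es v" if "(u, v) \<in> R\<^sup>+" for u v
    using that
  proof (induction rule: converse_trancl_induct)
    case (base u)
    then obtain S where "hwalk H u [(S, v)] v"
      by (auto simp: R_def)
    then show ?case
      by blast
  next
    case (step u d)
    then obtain S es where "hwalk H u ((S, d) # es) v"
      by (auto simp: R_def)
    then show ?case
      by blast
  qed
  have R_verts: "R\<^sup>+ \<subseteq> verts H \<times> verts H"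
    by (rule trancl_subset_Sigma) (use sub in \<open>auto simp: R_def\<close>)
  fix S d u
  assume edge: "(S, d) \<in> hedges H" "u \<in> S"
  then have ud: "(u, d) \<in> R"
    by (auto simp: R_def)
  have "{v. (v, u) \<in> R\<^sup>+} \<subset> {v. (v, d) \<in> R\<^sup>+}"
  proof
    show "{v. (v, u) \<in> R\<^sup>+} \<subseteq> {v. (v, d) \<in> R\<^sup>+}"
      using ud by (auto intro: trancl_into_trancl)
    have "(u, u) \<notin> R\<^sup>+"
      using walk acyc by (auto simp: acyclic_hypergraph_def)
    then show "{v. (v, u) \<in> R\<^sup>+} \<noteq> {v. (v, d) \<in> R\<^sup>+}"
      using ud by blast
  qed
  moreover have "finite {v. (v, d) \<in> R\<^sup>+}"
    by (rule finite_subset[OF _ fin]) (use R_verts in auto)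
  ultimately show "card {v. (v, u) \<in> R\<^sup>+} < card {v. (v, d) \<in> R\<^sup>+}"
    by (rule psubset_card_mono[rotated])
qed

text \<open>The homomorphic image of a proof may contain cycles; giving each vertex of the image the least
  rank of its preimages and keeping the hyperedge of such a preimage removes them.\<close>

lemma proof_imp_grounded:
  fixes P :: "('u, 'a) hypergraph" and H :: "('v, 'a) hypergraph"
  assumes P: "proof_for L T \<eta> P" and h: "homomorphism P H h"
    and \<nu>: "bij_betw \<nu> {1..card (verts H)} (verts H)"
  obtains X g where "grounded T H \<nu> X" "g \<in> X" "lab H (\<nu> g) = \<eta>" "card X \<le> ct P"
proof -
  have fin: "finite (verts P)" and acyc: "acyclic_hypergraph P"
    and sub: "\<And>S d. (S, d) \<in> hedges P \<Longrightarrow> S \<subseteq> verts P \<and> d \<in> verts P"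
    and leaf: "\<And>v. v \<in> leaves P \<Longrightarrow> lab P v \<in> T"
    using P by (auto simp: proof_for_def derivation_structure_def hypergraph_def)
  obtain v0 where v0: "sinks P = {v0}" "lab P v0 = \<eta>"
    using P by (auto simp: proof_for_def)
  have hv: "h v \<in> verts H" "lab H (h v) = lab P v" if "v \<in> verts P" for v
    using h that by (auto simp: homomorphism_def)
  obtain r :: "'u \<Rightarrow> nat" where r: "\<And>S d u. (S, d) \<in> hedges P \<Longrightarrow> u \<in> S \<Longrightarrow> r u < r d"
    using acyclic_hypergraph_rank[OF fin sub acyc] by blast
  define X where "X = {i \<in> {1..card (verts H)}. \<nu> i \<in> h ` verts P}"
  define r' where "r' i = (LEAST k. \<exists>v\<in>verts P. h v = \<nu> i \<and> r v = k)" for i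
  have im: "\<exists>i\<in>X. \<nu> i = h v" if "v \<in> verts P" for v
    using that hv(1)[OF that] \<nu> unfolding X_def bij_betw_def by force
  have "lab H (\<nu> i) \<in> T \<or> (\<exists>S\<subseteq>X. (\<nu> ` S, \<nu> i) \<in> hedges H \<and> (\<forall>j\<in>S. r' j < r' i))"
    if i: "i \<in> X" for i
  proof -
    obtain u where "u \<in> verts P" "h u = \<nu> i"
      using i by (auto simp: X_def)
    then have "\<exists>k. \<exists>v\<in>verts P. h v = \<nu> i \<and> r v = k"
      by blast
    from LeastI_ex[OF this] obtain v where v: "v \<in> verts P" "h v = \<nu> i" "r v = r' i"
      unfolding r'_def by blast
    show ?thesis
    proof (cases "v \<in> leaves P")
      case True
      with leaf hv v show ?thesis
        by metis
    next
      case False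
      then obtain S where S: "(S, v) \<in> hedges P"
        using v by (auto simp: leaves_def)
      \<comment> \<open>The premises are pulled back to indices; every vertex of the image of
        \<open>P\<close> has an index in \<open>X\<close>, so \<open>\<nu>\<close> maps
        \<open>S'\<close> onto the image of \<open>S\<close>.\<close>
      define S' where "S' = {j \<in> X. \<nu> j \<in> h ` S}"
      have "\<nu> ` S' = h ` S"
      proof
        show "h ` S \<subseteq> \<nu> ` S'"
          using im sub[OF S] unfolding S'_def by (smt (verit) image_iff mem_Collect_eq subset_iff)
      qed (auto simp: S'_def)
      moreover have "(h ` S, h v) \<in> hedges H"
        using h S by (auto simp: homomorphism_def)
      \<comment> \<open>Some preimage \<open>u\<close> of \<open>j\<close> lies in \<open>S\<close>,
        so \<open>r' j\<close> is at most \<open>r u\<close>, which is below \<open>r v\<close>.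
        That \<open>v\<close> attains the least rank for \<open>i\<close> closes the chain.\<close>
      moreover have "r' j < r' i" if j: "j \<in> S'" for j
      proof -
        obtain u where u: "u \<in> S" "h u = \<nu> j"
          using j unfolding S'_def by force
        with sub[OF S] have "r' j \<le> r u"
          unfolding r'_def by (intro Least_le) auto
        with r[OF S u(1)] v(3) show ?thesis
          by simp
      qed
      moreover have "S' \<subseteq> X"
        by (auto simp: S'_def)
      ultimately show ?thesis
        using v(2) by metis
    qed
  qed
  then have "grounded T H \<nu> X"
    unfolding grounded_def X_def by blast
  moreover have "v0 \<in> verts P"
    using v0 by (auto simp: sinks_def)
  then obtain g where "g \<in> X" "\<nu> g = h v0"
    using im by blast
  moreover have "card X \<le> ct P"
  proof -
    have "inj_on \<nu> X"
      by (rule inj_on_subset[OF bij_betw_imp_inj_on[OF \<nu>]]) (auto simp: X_def)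
    then have "card X = card (\<nu> ` X)"
      by (simp add: card_image)
    also have "\<dots> \<le> card (h ` verts P)"
      by (rule card_mono) (use fin in \<open>auto simp: X_def\<close>)
    also have "\<dots> \<le> ct P"
      using card_image_le[OF fin] by (simp add: ct_def)
    finally show ?thesis .
  qed
  ultimately show thesis
    using that hv v0 \<open>v0 \<in> verts P\<close> by metis
qed

text \<open>The indices themselves serve as vertices of the proof, which yields the vertex type
  \<open>nat\<close>, and \<open>\<nu>\<close> is the homomorphism. Labels are pulled back along
  \<open>\<nu>\<close>, so each chosen hyperedge inherits its entailment from
  \<open>H\<close>.\<close>

lemma grounded_imp_proof:
  fixes H :: "('v, 'a) hypergraph"
  assumes X: "grounded T H \<nu> X" and g: "g \<in> X" "lab H (\<nu> g) = \<eta>"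
    and H: "derivation_structure L T H"
    and \<nu>: "bij_betw \<nu> {1..card (verts H)} (verts H)"
  obtains P :: "(nat, 'a) hypergraph" and h
  where "proof_for L T \<eta> P" "homomorphism P H h" "ct P \<le> card X"
proof -
  obtain r :: "nat \<Rightarrow> nat" where r: "\<forall>i\<in>X. lab H (\<nu> i) \<in> T \<or>
      (\<exists>S\<subseteq>X. (\<nu> ` S, \<nu> i) \<in> hedges H \<and> (\<forall>j\<in>S. r j < r i))"
    using X by (auto simp: grounded_def)
  \<comment> \<open>A vertex labelled by an axiom becomes a leaf even where some hyperedge justifies
    it.\<close>
  define N where "N = {i \<in> X. lab H (\<nu> i) \<notin> T}"
  have "\<forall>i\<in>N. \<exists>S\<subseteq>X. (\<nu> ` S, \<nu> i) \<in> hedges H \<and> (\<forall>j\<in>S. r j < r i)"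
    using r by (auto simp: N_def)
  then obtain pr where pr: "\<And>i. i \<in> N \<Longrightarrow> pr i \<subseteq> X" "\<And>i. i \<in> N \<Longrightarrow> (\<nu> ` pr i, \<nu> i) \<in> hedges H"
      "\<And>i j. i \<in> N \<Longrightarrow> j \<in> pr i \<Longrightarrow> r j < r i"
    by metis
  define R where "R = {(j, i). i \<in> N \<and> j \<in> pr i}"
  \<comment> \<open>Vertices that do not lead to \<open>g\<close> would produce further sinks.
    Closure under premises keeps the chosen hyperedges inside \<open>Y\<close>.\<close>
  define Y where "Y = {j. (j, g) \<in> R\<^sup>*}"
  have Y_X: "j \<in> X" and Y_r: "r j \<le> r g" if "j \<in> Y" for j
  proof -
    have "(j, g) \<in> R\<^sup>*"
      using that by (simp add: Y_def)
    then have "j \<in> X \<and> r j \<le> r g"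
    proof (induction rule: converse_rtrancl_induct)
      case (step j i)
      then show ?case
        using pr(1)[of i] pr(3)[of i j] by (fastforce simp: R_def)
    qed (use g in simp)
    then show "j \<in> X" "r j \<le> r g"
      by auto
  qed
  have pr_Y: "pr i \<subseteq> Y" if "i \<in> Y" "i \<in> N" for i
    using that by (auto simp: Y_def R_def intro: converse_rtrancl_into_rtrancl)
  have \<nu>_mem: "\<nu> j \<in> verts H" if "j \<in> Y" for j
    using Y_X[OF that] X \<nu> unfolding grounded_def by (meson bij_betw_apply subsetD)
  define P where "P = \<lparr>verts = Y, hedges = {(pr i, i) |i. i \<in> Y \<inter> N}, lab = (\<lambda>i. lab H (\<nu> i))\<rparr>"
  have fin: "finite Y"
    using Y_X grounded_finite[OF X] by (meson finite_subset subsetI)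
  have hyp: "hypergraph L P"
    using fin pr_Y \<nu>_mem H
    by (auto simp: hypergraph_def P_def derivation_structure_def)
  have "derivation_structure L T P"
  proof -
    have "entails L ((\<lambda>i. lab H (\<nu> i)) ` pr i) (lab H (\<nu> i))" if "i \<in> N" for i
      using pr(2)[OF that] H by (auto simp: derivation_structure_def image_image)
    moreover have "lab H (\<nu> v) \<in> T" if "v \<in> Y" "v \<notin> N" for v
      using that Y_X by (auto simp: N_def)
    ultimately show ?thesis
      using hyp by (auto simp: derivation_structure_def P_def leaves_def)
  qed
  moreover have "acyclic_hypergraph P"
  proof -
    have "r u < r d" if "(S, d) \<in> hedges P" "u \<in> S" for S d u
      using that pr(3) by (auto simp: P_def)
    then have "r u < r v" if "hwalk P u es v" "es \<noteq> []" for u es v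
      using hwalk_rank_less[of P r, OF _ that] by blast
    then show ?thesis
      unfolding acyclic_hypergraph_def by blast
  qed
  moreover have "sinks P = {g}"
  proof (intro equalityI subsetI)
    fix j
    assume j: "j \<in> sinks P"
    then have "(j, g) \<in> R\<^sup>*"
      by (auto simp: sinks_def P_def Y_def)
    then show "j \<in> {g}"
    proof (cases rule: converse_rtranclE)
      case (step i)
      then have "i \<in> Y \<inter> N" "j \<in> pr i"
        by (auto simp: R_def Y_def)
      with j show ?thesis
        by (auto simp: sinks_def P_def)
    qed simp
  next
    fix j
    assume "j \<in> {g}"
    then have "j = g"
      by simp
    \<comment> \<open>Ranks in \<open>Y\<close> are at most that of \<open>g\<close>, and a premise
      ranks strictly below its conclusion, so \<open>g\<close> is never a premise.\<close>
    moreover have "g \<notin> pr i" if "i \<in> Y \<inter> N" for i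
      using Y_r[of i] pr(3)[of i g] that by auto
    ultimately show "j \<in> sinks P"
      by (auto simp: sinks_def P_def Y_def)
  qed
  moreover have "lab P g = \<eta>"
    using g by (simp add: P_def)
  ultimately have "proof_for L T \<eta> P"
    by (simp add: proof_for_def)
  moreover have "homomorphism P H \<nu>"
    using \<nu>_mem pr by (auto simp: homomorphism_def P_def)
  moreover have "ct P \<le> card X"
    unfolding ct_def P_def using Y_X grounded_finite[OF X] by (auto intro: card_mono)
  ultimately show thesis
    using that by blast
qed

section \<open>The verifier\<close>

text \<open>
  Stacks: 0 the part of the theory not yet visited, 1 the certificate, 2 the number of vertices that
  may still be added, in unary, 3 the goal sentence (reversed), 4 a label query, 5 scratch space,
  6 and 7 the indices of the vertices derived so far, 8 a hyperedge query, 9 the candidate vertex.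
  Stacks 6 and 7 form a zipper: words are written least significant bit first on 6 and
  most significant bit first on 7, because moving a word reverses it.
\<close>

datatype instr = Left | Copy | Right | Next | Begin | Add

text \<open>A prefix code with at most two symbols per instruction; the constants in the bounds on
  certificates come from these lengths.\<close>

fun code :: "instr \<Rightarrow> word" where
  "code Left = [Bit True, Bit True]"
| "code Copy = [Bit True, Bit False]"
| "code Right = [Sep]"
| "code Next = [Bit True, Sep]"
| "code Begin = [Bit False, Bit True]"
| "code Add = [Bit False, Bit False]"

definition add_candidate :: "access com" where
  "add_candidate = Cond 2 {None} skip (Seq (Pop 2) (move_word 9 [7]))"

text \<open>\<open>Next\<close> takes the detour over stack 5 because the oracle expects the
  sentence unreversed. \<open>Begin\<close> replaces the index in the label query but keeps the
  sentence, so one sentence serves several vertices. It puts the candidate at the bottom of stack 8,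
  so that premises copied later precede the conclusion, as the query format demands.\<close>

fun instr_com :: "instr \<Rightarrow> access com" where
  "instr_com Left = move_word 7 [6]"
| "instr_com Copy = move_word 7 [6, 8]"
| "instr_com Right = move_word 6 [7]"
| "instr_com Next = Cond 0 {None} skip
     (Seq (clear 4) (Seq (move_word 0 [5]) (Seq (move_bits 5 [4]) (Seq (Pop 5) (Push 4 Sep)))))"
| "instr_com Begin =
     Seq (clear 8) (Seq (clear 9) (Seq (move_word 4 []) (move_word 1 [4, 8, 9])))"
| "instr_com Add = Ask Is_Hyperedge 8 add_candidate (Ask Has_Label 4 add_candidate skip)"

text \<open>Soundness and completeness are argued on these functions; \<open>exec_instr\<close>
  relates them to programs and step counts.\<close>

fun effect :: "(access \<Rightarrow> word \<Rightarrow> bool) \<Rightarrow> instr \<Rightarrow> store \<Rightarrow> store" where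
  "effect Q Left s = s(7 := rest_words (s 7), 6 := rev (head_word (s 7)) @ Sep # s 6)"
| "effect Q Copy s = s(7 := rest_words (s 7), 6 := rev (head_word (s 7)) @ Sep # s 6,
     8 := rev (head_word (s 7)) @ Sep # s 8)"
| "effect Q Right s = s(6 := rest_words (s 6), 7 := rev (head_word (s 6)) @ Sep # s 7)"
| "effect Q Next s =
     (if s 0 = [] then s else s(0 := rest_words (s 0), 4 := Sep # head_word (s 0)))"
| "effect Q Begin s = s(1 := rest_words (s 1),
     4 := rev (head_word (s 1)) @ Sep # rest_words (s 4),
     8 := rev (head_word (s 1)) @ [Sep], 9 := rev (head_word (s 1)) @ [Sep])"
| "effect Q Add s =
     (if (Q Is_Hyperedge (s 8) \<or> Q Has_Label (s 4)) \<and> s 2 \<noteq> []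
      then s(2 := tl (s 2), 9 := rest_words (s 9), 7 := rev (head_word (s 9)) @ Sep # s 7)
      else s)"

section \<open>Control flow of the verifier\<close>

definition branch :: "nat \<Rightarrow> 'q com \<Rightarrow> 'q com \<Rightarrow> 'q com \<Rightarrow> 'q com" where
  "branch a c1 c2 c3 = Cond a {Some (Bit True)} (Seq (Pop a) c1)
     (Cond a {Some (Bit False)} (Seq (Pop a) c2) (Seq (Pop a) c3))"

text \<open>Total by design: \<open>Bit False\<close> followed by anything but
  \<open>Bit True\<close> counts as \<open>Add\<close>, so any certificate can be executed.\<close>

definition dispatch :: "access com" where
  "dispatch = branch 1
     (branch 1 (instr_com Left) (instr_com Copy) (instr_com Next))
     (branch 1 (instr_com Begin) (instr_com Add) (instr_com Add))
     (instr_com Right)"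

definition main_loop :: "access com" where
  "main_loop = While 1 (- {None}) dispatch"

text \<open>The initial contents of stacks 4 and 8 are queries with an empty index, which no vertex
  has; so \<open>Add\<close> changes nothing before the first \<open>Begin\<close>.\<close>

definition prepare :: "access com" where
  "prepare = Seq (move_bits 0 [2]) (Seq (Pop 0) (Seq (move_bits 0 [3]) (Seq (Pop 0)
     (Seq (Push 4 Sep) (Seq (Push 4 Sep) (Push 8 Sep))))))"

text \<open>The label is tested for the top of stack 7, so the certificate selects the goal vertex
  by its final moves. Moving stack 3 undoes the reversal of the goal sentence, and the verdict goes
  to stack 0, where \<open>accepting\<close> looks.\<close>

definition check_goal :: "access com" where
  "check_goal = Seq (clear 4) (Seq (move_bits 3 [4]) (Seq (move_word 7 [4])
     (Ask Has_Label 4 (Push 0 (Bit True)) (Push 0 (Bit False)))))"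

definition verifier :: "access com" where
  "verifier = Seq prepare (Seq main_loop check_goal)"

section \<open>Running time of single instructions\<close>

definition instr_cost :: "store \<Rightarrow> nat" where
  "instr_cost s = 12 * (length (s 0) + length (s 1) + length (s 4) + length (s 6) + length (s 7) +
     length (s 8) + length (s 9) + 1)"

text \<open>The final store is described pointwise, so it can be given as any nest of updates. The
  time is relaxed from the moved word to the whole stack, whose length the invariants
  control.\<close>

lemma exec_move_word_effect:
  assumes "a \<notin> set bs" "distinct bs"
    and "\<And>r. s' r = (if r = a then rest_words (s a)
          else if r \<in> set bs then rev (head_word (s a)) @ Sep # s r else s r)"
  shows "\<exists>t \<le> (length bs + 3) * (length (s a) + 1). exec Q (move_word a bs) s t s'"
proof -
  have "s' = (\<lambda>r. if r = a then rest_words (s a)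
          else if r \<in> set bs then rev (head_word (s a)) @ Sep # s r else s r)"
    using assms(3) by (intro ext)
  then have "exec Q (move_word a bs) s
      (length bs + (length (head_word (s a)) * (length bs + 3) + 1 + 1)) s'"
    using exec_move_word[OF assms(1,2), of Q s] by (simp only:)
  moreover have "length (head_word (s a)) * (length bs + 3) \<le> length (s a) * (length bs + 3)"
    by (intro mult_right_mono length_head_word) simp
  then have "length bs + (length (head_word (s a)) * (length bs + 3) + 1 + 1)
      \<le> (length bs + 3) * (length (s a) + 1)"
    by (simp add: algebra_simps)
  ultimately show ?thesis
    by blast
qed

lemma exec_move_bits_effect:
  assumes "a \<notin> set bs" "distinct bs"
    and "\<And>r. s' r = (if r = a then dropWhile (\<lambda>x. x \<noteq> Sep) (s a)
          else if r \<in> set bs then rev (head_word (s a)) @ s r else s r)"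
  shows "\<exists>t \<le> (length bs + 3) * (length (s a) + 1). exec Q (move_bits a bs) s t s'"
proof -
  have "s' = (\<lambda>r. if r = a then dropWhile (\<lambda>x. x \<noteq> Sep) (s a)
          else if r \<in> set bs then rev (head_word (s a)) @ s r else s r)"
    using assms(3) by (intro ext)
  then have "exec Q (move_bits a bs) s (length (head_word (s a)) * (length bs + 3) + 1) s'"
    using exec_move_bits[OF assms(1,2), of Q s] by (simp only:)
  moreover have "length (head_word (s a)) * (length bs + 3) \<le> length (s a) * (length bs + 3)"
    by (intro mult_right_mono length_head_word) simp
  then have "length (head_word (s a)) * (length bs + 3) + 1 \<le> (length bs + 3) * (length (s a) + 1)"
    by (simp add: algebra_simps)
  ultimately show ?thesis
    by blast
qed

lemma exec_clear_effect:
  assumes "s' = s(a := [])"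
  shows "\<exists>t \<le> 2 * length (s a) + 1. exec Q (clear a) s t s'"
  using exec_clear assms by blast

lemma exec_Seq_bound:
  assumes "\<exists>t\<le>b1. exec Q c1 s t s1" and "\<exists>t\<le>b2. exec Q c2 s1 t s2"
  shows "\<exists>t\<le>b1 + b2. exec Q (Seq c1 c2) s t s2"
  using assms by (metis Seq add_mono)

lemma exec_Push_bound: "s' = s(r := a # s r) \<Longrightarrow> \<exists>t\<le>1. exec Q (Push r a) s t s'"
  using Push by blast

lemma exec_Pop_bound: "s' = s(r := tl (s r)) \<Longrightarrow> \<exists>t\<le>1. exec Q (Pop r) s t s'"
  using Pop by blast

lemma exec_Cond_bound:
  assumes "\<exists>t\<le>b. exec Q (if top_of (s r) \<in> A then c1 else c2) s t s'"
  shows "\<exists>t\<le>b + 1. exec Q (Cond r A c1 c2) s t s'"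
  using assms by (metis CondTrue CondFalse add_le_mono1)

lemma exec_Ask_bound:
  assumes "\<exists>t\<le>b. exec Q (if Q q (s r) then c1 else c2) s t s'"
  shows "\<exists>t\<le>b + 1. exec Q (Ask q r c1 c2) s t s'"
  using assms by (metis AskTrue AskFalse add_le_mono1)

lemma exec_bound_mono:
  "\<exists>t\<le>b. exec Q c s t s' \<Longrightarrow> b \<le> b' \<Longrightarrow> \<exists>t\<le>b'. exec Q c s t s'"
  using order_trans by blast

lemma top_of_None_iff [simp]: "top_of w = None \<longleftrightarrow> w = []"
  by (simp add: top_of_def split: list.split)

lemma exec_add_candidate:
  assumes "s' = (if s 2 = [] then s
    else s(2 := tl (s 2), 9 := rest_words (s 9), 7 := rev (head_word (s 9)) @ Sep # s 7))"
  shows "\<exists>t\<le>4 * length (s 9) + 6. exec Q add_candidate s t s'"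
proof (cases "s 2 = []")
  case True
  with assms have "\<exists>t\<le>1. exec Q skip s t s'"
    using exec_skip by auto
  with True have "\<exists>t\<le>1 + 1. exec Q add_candidate s t s'"
    unfolding add_candidate_def by (intro exec_Cond_bound) simp
  then show ?thesis
    by (rule exec_bound_mono) simp
next
  case False
  define s1 where "s1 = s(2 := tl (s 2))"
  have "\<exists>t\<le>(length [7 :: nat] + 3) * (length (s1 9) + 1). exec Q (move_word 9 [7]) s1 t s'"
    by (rule exec_move_word_effect) (use False in \<open>auto simp: assms s1_def\<close>)
  with exec_Pop_bound[of s1 s 2 Q]
  have "\<exists>t\<le>1 + (length [7 :: nat] + 3) * (length (s1 9) + 1).
      exec Q (Seq (Pop 2) (move_word 9 [7])) s t s'"
    by (intro exec_Seq_bound) (auto simp: s1_def)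
  with False have "\<exists>t\<le>1 + (length [7 :: nat] + 3) * (length (s1 9) + 1) + 1.
      exec Q add_candidate s t s'"
    unfolding add_candidate_def by (intro exec_Cond_bound) simp
  then show ?thesis
    by (rule exec_bound_mono) (simp add: s1_def)
qed

text \<open>The \<open>Sep\<close> that the first move leaves on the empty scratch stack stops the
  second move; popping it leaves stack 5 empty again.\<close>

lemma exec_next:
  assumes "s 5 = []"
  shows "\<exists>t\<le>instr_cost s. exec Q (instr_com Next) s t (effect Q Next s)"
proof (cases "s 0 = []")
  case True
  then have "\<exists>t\<le>1 + 1. exec Q (instr_com Next) s t (effect Q Next s)"
    unfolding instr_com.simps using exec_skip by (intro exec_Cond_bound) auto
  then show ?thesis
    by (rule exec_bound_mono) (simp add: instr_cost_def)
next
  case False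
  define h where "h = head_word (s 0)"
  obtain b where h: "h = map Bit b"
    using head_word_is_bits h_def by metis
  define s1 where "s1 = s(4 := [])"
  define s2 where "s2 = s1(0 := rest_words (s 0), 5 := rev h @ [Sep])"
  define s3 where "s3 = s2(5 := [Sep], 4 := h)"
  define s4 where "s4 = s3(5 := [])"
  have 1: "\<exists>t\<le>2 * length (s 4) + 1. exec Q (clear 4) s t s1"
    by (rule exec_clear_effect[of s1 s 4]) (simp add: s1_def)
  have 2: "\<exists>t\<le>(length [5 :: nat] + 3) * (length (s1 0) + 1). exec Q (move_word 0 [5]) s1 t s2"
    by (rule exec_move_word_effect) (use assms in \<open>auto simp: s2_def s1_def h_def\<close>)
  have 3: "\<exists>t\<le>(length [4 :: nat] + 3) * (length (s2 5) + 1). exec Q (move_bits 5 [4]) s2 t s3"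
    by (rule exec_move_bits_effect) (auto simp: s3_def s2_def s1_def h)
  have 4: "\<exists>t\<le>1. exec Q (Pop 5) s3 t s4"
    by (rule exec_Pop_bound) (simp add: s4_def s3_def)
  have "effect Q Next s = s4(4 := Sep # s4 4)"
    using False assms by (auto simp: s4_def s3_def s2_def s1_def h_def fun_eq_iff)
  then have 5: "\<exists>t\<le>1. exec Q (Push 4 Sep) s4 t (effect Q Next s)"
    by (rule exec_Push_bound)
  have "top_of (s 0) \<notin> {None}"
    using False by simp
  then have "\<exists>t\<le>2 * length (s 4) + 1 + ((length [5 :: nat] + 3) * (length (s1 0) + 1) +
      ((length [4 :: nat] + 3) * (length (s2 5) + 1) + (1 + 1))) + 1.
      exec Q (instr_com Next) s t (effect Q Next s)"
    unfolding instr_com.simps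
    by (intro exec_Cond_bound) (simp only: if_False exec_Seq_bound[OF 1 exec_Seq_bound[OF 2
          exec_Seq_bound[OF 3 exec_Seq_bound[OF 4 5]]]])
  \<comment> \<open>The additive constants sum to 16. As stack 0 is nonempty, its share of the
    factor 12 in \<open>instr_cost\<close> absorbs the excess.\<close>
  moreover have "length h \<le> length (s 0)" "1 \<le> length (s 0)"
    unfolding h_def using length_head_word False by (auto simp: Suc_le_eq)
  ultimately show ?thesis
    by (elim exec_bound_mono) (simp add: s2_def s1_def instr_cost_def)
qed

lemma exec_begin:
  shows "\<exists>t\<le>instr_cost s. exec Q (instr_com Begin) s t (effect Q Begin s)"
proof -
  define s1 where "s1 = s(8 := [])"
  define s2 where "s2 = s1(9 := [])"
  define s3 where "s3 = s2(4 := rest_words (s 4))"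
  have 1: "\<exists>t\<le>2 * length (s 8) + 1. exec Q (clear 8) s t s1"
    by (rule exec_clear_effect[of s1 s 8]) (simp add: s1_def)
  have 2: "\<exists>t\<le>2 * length (s1 9) + 1. exec Q (clear 9) s1 t s2"
    by (rule exec_clear_effect[of s2 s1 9]) (simp add: s2_def)
  have 3: "\<exists>t\<le>(length ([] :: nat list) + 3) * (length (s2 4) + 1). exec Q (move_word 4 []) s2 t s3"
    by (rule exec_move_word_effect) (auto simp: s3_def s2_def s1_def)
  have 4: "\<exists>t\<le>(length [4, 8, 9 :: nat] + 3) * (length (s3 1) + 1).
      exec Q (move_word 1 [4, 8, 9]) s3 t (effect Q Begin s)"
    by (rule exec_move_word_effect) (auto simp: s3_def s2_def s1_def)
  from exec_Seq_bound[OF 1 exec_Seq_bound[OF 2 exec_Seq_bound[OF 3 4]]] show ?thesis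
    unfolding instr_com.simps
    by (rule exec_bound_mono) (simp add: s3_def s2_def s1_def instr_cost_def)
qed

lemma exec_instr:
  assumes "s 5 = []"
  shows "\<exists>t\<le>instr_cost s. exec Q (instr_com i) s t (effect Q i s)"
proof (cases i)
  case Left
  have "\<exists>t\<le>(length [6 :: nat] + 3) * (length (s 7) + 1).
      exec Q (move_word 7 [6]) s t (effect Q Left s)"
    by (rule exec_move_word_effect) auto
  then show ?thesis
    unfolding Left instr_com.simps by (rule exec_bound_mono) (simp add: instr_cost_def)
next
  case Copy
  have "\<exists>t\<le>(length [6, 8 :: nat] + 3) * (length (s 7) + 1).
      exec Q (move_word 7 [6, 8]) s t (effect Q Copy s)"
    by (rule exec_move_word_effect) auto
  then show ?thesis
    unfolding Copy instr_com.simps by (rule exec_bound_mono) (simp add: instr_cost_def)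
next
  case Right
  have "\<exists>t\<le>(length [7 :: nat] + 3) * (length (s 6) + 1).
      exec Q (move_word 6 [7]) s t (effect Q Right s)"
    by (rule exec_move_word_effect) auto
  then show ?thesis
    unfolding Right instr_com.simps by (rule exec_bound_mono) (simp add: instr_cost_def)
next
  case Next
  then show ?thesis
    using exec_next[of s Q, OF assms] by simp
next
  case Begin
  then show ?thesis
    using exec_begin by simp
next
  case Add
  \<comment> \<open>Either oracle can license the addition; naming the outcome lets one analysis
    serve both routes.\<close>
  define c :: "access com" where
    "c = (if Q Is_Hyperedge (s 8) \<or> Q Has_Label (s 4) then add_candidate else skip)"
  have cand: "\<exists>t\<le>4 * length (s 9) + 6. exec Q c s t (effect Q Add s)"
  proof (cases "Q Is_Hyperedge (s 8) \<or> Q Has_Label (s 4)")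
    case True
    then show ?thesis
      unfolding c_def by (simp only: if_True) (rule exec_add_candidate[of "effect Q Add s" s Q], simp)
  next
    case False
    then have "effect Q Add s = s"
      by simp
    then have "exec Q c s 1 (effect Q Add s)"
      unfolding c_def if_not_P[OF False] by (simp only: exec_skip)
    then show ?thesis
      by (intro exI[of _ 1]) simp
  qed
  from cand have c: "\<exists>t\<le>4 * length (s 9) + 6 + 1. exec Q c s t (effect Q Add s)"
    by (rule exec_bound_mono) simp
  have "\<exists>t\<le>4 * length (s 9) + 6 + 1. exec Q (if Q Is_Hyperedge (s 8) then add_candidate
      else Ask Has_Label 4 add_candidate skip) s t (effect Q Add s)"
  proof (cases "Q Is_Hyperedge (s 8)")
    case True
    then show ?thesis
      using c by (simp only: c_def simp_thms if_True)
  next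
    case False
    then have "\<exists>t\<le>4 * length (s 9) + 6.
        exec Q (if Q Has_Label (s 4) then add_candidate else skip) s t (effect Q Add s)"
      using cand by (simp only: c_def simp_thms)
    from exec_Ask_bound[OF this] False show ?thesis
      by (simp only: if_False)
  qed
  from exec_Ask_bound[OF this]
  have "\<exists>t\<le>4 * length (s 9) + 6 + 1 + 1. exec Q (instr_com Add) s t (effect Q Add s)"
    unfolding instr_com.simps .
  then show ?thesis
    unfolding Add by (rule exec_bound_mono) (simp add: instr_cost_def)
qed

section \<open>Decoding of certificates\<close>

lemma exec_branch:
  assumes "\<exists>t\<le>b. exec Q (if top_of (s a) = Some (Bit True) then c1
    else if top_of (s a) = Some (Bit False) then c2 else c3) (s(a := tl (s a))) t s'"
  shows "\<exists>t\<le>b + 3. exec Q (branch a c1 c2 c3) s t s'"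
proof -
  define c where "c = (if top_of (s a) = Some (Bit True) then c1
    else if top_of (s a) = Some (Bit False) then c2 else c3)"
  have pop: "\<exists>t\<le>1 + b. exec Q (Seq (Pop a) c) s t s'"
    using assms unfolding c_def
    by (rule exec_Seq_bound[OF exec_Pop_bound[of "s(a := tl (s a))" s a, OF refl]])
  have "\<exists>t\<le>1 + b + 1. exec Q (if top_of (s a) \<in> {Some (Bit True)} then Seq (Pop a) c1
      else Cond a {Some (Bit False)} (Seq (Pop a) c2) (Seq (Pop a) c3)) s t s'"
  proof (cases "top_of (s a) = Some (Bit True)")
    case True
    with pop show ?thesis
      unfolding c_def by (auto intro: exec_bound_mono)
  next
    case False
    have "\<exists>t\<le>1 + b. exec Q (if top_of (s a) \<in> {Some (Bit False)} then Seq (Pop a) c2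
        else Seq (Pop a) c3) s t s'"
      using pop False unfolding c_def by (auto split: if_splits)
    from exec_Cond_bound[OF this] show ?thesis
      using False by simp
  qed
  from exec_Cond_bound[OF this] have "\<exists>t\<le>1 + b + 1 + 1. exec Q (branch a c1 c2 c3) s t s'"
    unfolding branch_def .
  then show ?thesis
    by (rule exec_bound_mono) simp
qed

text \<open>The functional counterpart of \<open>dispatch\<close>, total like it: even a lone
  \<open>Bit True\<close> at the end of a certificate denotes an instruction.\<close>

fun decode :: "word \<Rightarrow> instr" where
  "decode (Bit True # Bit True # w) = Left"
| "decode (Bit True # Bit False # w) = Copy"
| "decode (Bit True # w) = Next"
| "decode (Bit False # Bit True # w) = Begin"
| "decode (Bit False # w) = Add"
| "decode w = Right"

fun undecoded :: "word \<Rightarrow> word" where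
  "undecoded (Bit b # w) = tl w"
| "undecoded w = tl w"

lemma decode_code [simp]: "decode (code i @ w) = i" "undecoded (code i @ w) = w"
  by (cases i; simp)+

lemma length_undecoded: "w \<noteq> [] \<Longrightarrow> length (undecoded w) < length w"
  by (cases w rule: undecoded.cases) auto

text \<open>At most two nested branches with an overhead of 3 each give the 6.\<close>

lemma exec_dispatch:
  assumes "s 5 = []"
  shows "\<exists>t\<le>instr_cost (s(1 := undecoded (s 1))) + 6.
    exec Q dispatch s t (effect Q (decode (s 1)) (s(1 := undecoded (s 1))))"
    (is "\<exists>t\<le>?b + 6. exec Q _ s t ?s'")
proof -
  let ?s2 = "s(1 := undecoded (s 1))"
  have instr: "\<exists>t\<le>?b. exec Q (instr_com (decode (s 1))) ?s2 t ?s'"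
    by (rule exec_instr) (use assms in simp)
  show ?thesis
  proof (cases "s 1")
    case Nil
    with instr have "\<exists>t\<le>?b + 3. exec Q dispatch s t ?s'"
      unfolding dispatch_def by (intro exec_branch) (simp add: top_of_def)
    then show ?thesis
      by (rule exec_bound_mono) simp
  next
    case (Cons x w)
    show ?thesis
    proof (cases x)
      case Sep
      with Cons instr have "\<exists>t\<le>?b + 3. exec Q dispatch s t ?s'"
        unfolding dispatch_def by (intro exec_branch) (simp add: top_of_def)
      then show ?thesis
        by (rule exec_bound_mono) simp
    next
      case (Bit b)
      define s1 where "s1 = s(1 := w)"
      have s2: "?s2 = s1(1 := tl (s1 1))"
        using Cons Bit by (simp add: s1_def)
      have "\<exists>t\<le>?b + 3. exec Q
          (if b then branch 1 (instr_com Left) (instr_com Copy) (instr_com Next)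
           else branch 1 (instr_com Begin) (instr_com Add) (instr_com Add)) s1 t ?s'"
      proof (cases b)
        case True
        have "decode (s 1) = (if top_of (s1 1) = Some (Bit True) then Left
            else if top_of (s1 1) = Some (Bit False) then Copy else Next)"
          using Cons Bit True
          by (cases w rule: undecoded.cases) (auto simp: s1_def top_of_def)
        with instr have "\<exists>t\<le>?b. exec Q (if top_of (s1 1) = Some (Bit True) then instr_com Left
            else if top_of (s1 1) = Some (Bit False) then instr_com Copy else instr_com Next)
            ?s2 t ?s'"
          by (auto split: if_splits)
        from exec_branch[where s = s1 and a = 1, OF this[unfolded s2]] show ?thesis
          using True by (simp only: s2 if_True)
      next
        case False
        have "decode (s 1) = (if top_of (s1 1) = Some (Bit True) then Begin
            else if top_of (s1 1) = Some (Bit False) then Add else Add)"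
          using Cons Bit False
          by (cases w rule: undecoded.cases) (auto simp: s1_def top_of_def)
        with instr have "\<exists>t\<le>?b. exec Q (if top_of (s1 1) = Some (Bit True) then instr_com Begin
            else if top_of (s1 1) = Some (Bit False) then instr_com Add else instr_com Add)
            ?s2 t ?s'"
          by (auto split: if_splits)
        from exec_branch[where s = s1 and a = 1, OF this[unfolded s2]] show ?thesis
          using False by (simp only: s2 if_False)
      qed
      then have "\<exists>t\<le>?b + 3 + 3. exec Q dispatch s t ?s'"
        unfolding dispatch_def
        by (intro exec_branch) (cases b; use Cons Bit in
            \<open>simp add: top_of_def s1_def del: instr_com.simps\<close>)
      then show ?thesis
        by (rule exec_bound_mono) simp
    qed
  qed
qed

lemma exec_main_loop_step:
  assumes "s 1 = code i @ w" and "s 5 = []"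
    and "exec Q main_loop (effect Q i (s(1 := w))) t s'"
  shows "\<exists>t. exec Q main_loop s t s'"
proof -
  obtain t1 where "exec Q dispatch s t1 (effect Q i (s(1 := w)))"
    using exec_dispatch[of s Q] assms(1,2) by auto
  moreover have "top_of (s 1) \<in> - {None}"
    using assms(1) by (cases i) auto
  ultimately have "exec Q main_loop s (t1 + t + 1) s'"
    using assms(3) unfolding main_loop_def by (rule_tac WhileTrue)
  then show ?thesis
    by blast
qed

lemma exec_main_loop_end: "s 1 = [] \<Longrightarrow> exec Q main_loop s 1 s"
  unfolding main_loop_def by (rule WhileFalse) simp

text \<open>The last two conditions are potentials: each instruction consumes part of the certificate
  and lengthens stack 8 by at most \<open>N + 1\<close> and stack 4 by at most \<open>2 * N + 3\<close> symbols.\<close>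

definition small_store :: "nat \<Rightarrow> store \<Rightarrow> bool" where
  "small_store N s \<longleftrightarrow> s 5 = [] \<and> length (s 0) \<le> N \<and> length (s 3) \<le> N \<and>
     length (s 1) + length (s 6) + length (s 7) + length (s 9) \<le> N \<and>
     length (s 8) + (N + 1) * length (s 1) \<le> (N + 1) * (N + 1) \<and>
     length (s 4) + (2 * N + 3) * length (s 1) \<le> (2 * N + 3) * (N + 1)"

text \<open>\<open>K\<close> collects the stacks between which words merely move. An instruction
  adds at most one symbol to it, the separator written when the source word is not closed by a
  \<open>Sep\<close>; the consumed part of the certificate pays for that symbol.\<close>

lemma effect_lengths:
  defines "K s \<equiv> length (s 1) + length (s 6) + length (s 7) + length (s 9)"
  shows "effect Q i s 5 = s 5" "effect Q i s 3 = s 3"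
    "length (effect Q i s 0) \<le> length (s 0)"
    "length (effect Q i s 1) \<le> length (s 1)"
    "K (effect Q i s) \<le> K s + 1"
    "length (effect Q i s 8) \<le> length (s 8) + K s + 1"
    "length (effect Q i s 4) \<le> length (s 4) + length (s 0) + K s + 1"
  using length_head_rest[of "s 0"] length_head_rest[of "s 1"] length_head_rest[of "s 4"]
    length_head_rest[of "s 6"] length_head_rest[of "s 7"] length_head_rest[of "s 9"]
  by (cases i; simp add: K_def del: length_tl)+

lemma small_store_effect:
  assumes "small_store N s" and "length w < length (s 1)"
  shows "small_store N (effect Q i (s(1 := w)))"
proof -
  let ?s = "s(1 := w)"
  let ?s' = "effect Q i ?s"
  have s: "s 5 = []" "length (s 0) \<le> N" "length (s 3) \<le> N"
     "length (s 1) + length (s 6) + length (s 7) + length (s 9) \<le> N"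
     "length (s 8) + (N + 1) * length (s 1) \<le> (N + 1) * (N + 1)"
     "length (s 4) + (2 * N + 3) * length (s 1) \<le> (2 * N + 3) * (N + 1)"
    using assms(1) by (simp_all only: small_store_def)
  have len: "length (?s' 1) \<le> length w"
    using effect_lengths(4)[of Q i ?s] by simp
  \<comment> \<open>Each consumed certificate symbol releases \<open>a\<close> units of potential.
    With \<open>a\<close> equal to \<open>N + 1\<close> and \<open>2 * N + 3\<close> this covers the
    growth of stacks 8 and 4.\<close>
  have step: "a * length (?s' 1) + a \<le> a * length (s 1)" for a
  proof -
    have "a * length (?s' 1) + a = a * (length (?s' 1) + 1)"
      by simp
    also have "\<dots> \<le> a * length (s 1)"
      using len assms(2) by (intro mult_left_mono) auto
    finally show ?thesis .
  qed
  show ?thesis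
    unfolding small_store_def
    using s assms(2) effect_lengths[of Q i ?s] step[of "N + 1"] step[of "2 * N + 3"]
    by (simp del: effect.simps length_tl mult_Suc_right mult_Suc add_mult_distrib)
qed

text \<open>The summands bound stack 0 together with stacks 1, 6, 7 and 9, then stack 8, then stack
  4.\<close>

lemma instr_cost_small:
  assumes "small_store N s" and "length w \<le> length (s 1)"
  shows "instr_cost (s(1 := w)) \<le> 12 * (2 * N + (N + 1) * (N + 1) + (2 * N + 3) * (N + 1) + 1)"
  using assms by (simp add: small_store_def instr_cost_def)

text \<open>Running time and an arbitrary invariant \<open>P\<close> come from one induction on the
  certificate length; \<open>P\<close> will be \<open>sound_store\<close>. The 7 is the overhead of
  \<open>dispatch\<close> plus the loop test.\<close>

lemma exec_main_loop:
  assumes "small_store N s" and "P s"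
    and step: "\<And>s w. P s \<Longrightarrow> P (effect Q (decode (s 1)) (s(1 := w)))"
  shows "\<exists>t s'. exec Q main_loop s t s' \<and>
    t \<le> length (s 1) *
      (12 * (2 * N + (N + 1) * (N + 1) + (2 * N + 3) * (N + 1) + 1) + 7) + 1 \<and>
    small_store N s' \<and> P s'"
    (is "\<exists>t s'. _ \<and> t \<le> _ * (?B + 7) + 1 \<and> _ \<and> _")
  using assms(1,2)
proof (induction "length (s 1)" arbitrary: s rule: less_induct)
  case less
  show ?case
  proof (cases "s 1 = []")
    case True
    with less.prems exec_main_loop_end[of s Q] show ?thesis
      by (metis le_add2)
  next
    case False
    let ?w = "undecoded (s 1)"
    let ?s1 = "effect Q (decode (s 1)) (s(1 := ?w))"
    have w: "length ?w < length (s 1)"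
      by (rule length_undecoded[OF False])
    have "s 5 = []"
      using less.prems(1) by (simp add: small_store_def)
    from exec_dispatch[of s Q, OF this] obtain t1
      where t1: "exec Q dispatch s t1 ?s1" "t1 \<le> instr_cost (s(1 := ?w)) + 6"
      by blast
    have "instr_cost (s(1 := ?w)) \<le> ?B"
      using instr_cost_small[OF less.prems(1)] w by simp
    with t1 have t1_B: "t1 \<le> ?B + 6"
      by linarith
    have len: "length (?s1 1) \<le> length ?w"
      using effect_lengths(4)[of Q "decode (s 1)" "s(1 := ?w)"] by simp
    have "small_store N ?s1" "P ?s1"
      using small_store_effect[OF less.prems(1) w] step[OF less.prems(2)] by auto
    with less.hyps[of ?s1] len w obtain t2 s' where t2: "exec Q main_loop ?s1 t2 s'"
      "t2 \<le> length (?s1 1) * (?B + 7) + 1" "small_store N s'" "P s'"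
      by (meson order_le_less_trans)
    have "exec Q main_loop s (t1 + t2 + 1) s'"
      using t1(1) t2(1) False unfolding main_loop_def by (rule_tac WhileTrue) simp_all
    moreover have "t1 + t2 + 1 \<le> length (s 1) * (?B + 7) + 1"
    proof -
      have "(length (?s1 1) + 1) * (?B + 7) \<le> length (s 1) * (?B + 7)"
        using len w by (intro mult_right_mono) auto
      then have "length (?s1 1) * (?B + 7) + (?B + 7) \<le> length (s 1) * (?B + 7)"
        by (simp only: add_mult_distrib mult_1)
      with t1_B t2(2) show ?thesis
        by linarith
    qed
    ultimately show ?thesis
      using t2 by blast
  qed
qed

section \<open>Soundness\<close>

lemma binary_0 [simp]: "binary 0 = []"
  by (simp add: binary.simps)

lemma binary_Nil_iff [simp]: "binary n = [] \<longleftrightarrow> n = 0"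
  by (subst binary.simps) simp

lemma binary_inj: "binary m = binary n \<Longrightarrow> m = n"
proof (induction m arbitrary: n rule: binary.induct)
  case (1 m)
  show ?case
  proof (cases "m = 0 \<or> n = 0")
    case True
    with "1.prems" show ?thesis
      by (metis binary_Nil_iff)
  next
    case False
    then have "odd m = odd n" "binary (m div 2) = binary (n div 2)"
      using "1.prems" by (simp_all add: binary.simps[of m] binary.simps[of n])
    with "1.IH"[of "n div 2"] False show ?thesis
      by (metis div_mult_mod_eq mod2_eq_if)
  qed
qed

lemma length_binary_mono: "m \<le> n \<Longrightarrow> length (binary m) \<le> length (binary n)"
proof (induction n arbitrary: m rule: binary.induct)
  case (1 n)
  show ?case
  proof (cases "m = 0")
    case False
    with 1 have "length (binary (m div 2)) \<le> length (binary (n div 2))"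
      by (metis div_le_mono le_zero_eq)
    with False 1 show ?thesis
      by (simp add: binary.simps[of m] binary.simps[of n])
  qed simp
qed

lemma access_label_iff:
  "access_answer L enc H \<nu> Has_Label (map Bit c @ Sep # w) \<longleftrightarrow>
   (\<exists>i\<in>{1..card (verts H)}. c = binary i \<and> lab H (\<nu> i) \<in> sentences L \<and>
      w = map Bit (enc (lab H (\<nu> i))))"
  by (auto simp: bits_Sep_eq_iff)

text \<open>Unique parsing of \<open>blocks\<close> and injectivity of \<open>binary\<close> recover
  the indices from the query word. Premises enter as a set, so their order in the query is
  free.\<close>

lemma access_hyperedge_iff:
  "access_answer L enc H \<nu> Is_Hyperedge (blocks (map binary js) @ map Bit c @ [Sep]) \<longleftrightarrow>
   (\<exists>i\<in>{1..card (verts H)}. c = binary i \<and> set js \<subseteq> {1..card (verts H)} \<and>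
      (\<nu> ` set js, \<nu> i) \<in> hedges H)"
proof -
  have inj: "inj binary"
    by (simp add: inj_def binary_inj)
  have "concat (map (\<lambda>j. map Bit (binary j) @ [Sep]) (is @ [i])) = blocks (map binary is @ [binary i])"
    for "is" i
    by (simp add: blocks_def comp_def)
  moreover have "blocks (map binary js) @ map Bit c @ [Sep] = blocks (map binary js @ [c])"
    by (simp add: blocks_append)
  moreover have "blocks (map binary js @ [c]) = blocks (map binary is @ [binary i]) \<longleftrightarrow>
      js = is \<and> c = binary i" for "is" i
    using blocks_inj[of "map binary js @ [c]" "map binary is @ [binary i]"]
    by (auto simp: inj_map_eq_map[OF inj])
  ultimately show ?thesis
    by auto
qed

text \<open>The index 0, written as the empty word, occurs when an instruction pops an empty stack. It is not
  the index of a vertex, so every query that mentions it is answered negatively.\<close>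

definition sound_store ::
    "('a \<Rightarrow> bool list) \<Rightarrow> 'a set \<Rightarrow> 'a \<Rightarrow> ('v, 'a) hypergraph \<Rightarrow> (nat \<Rightarrow> 'v) \<Rightarrow> nat \<Rightarrow> store \<Rightarrow> bool"
  where
  "sound_store enc T \<eta> H \<nu> n s \<longleftrightarrow> s 3 = rev (map Bit (enc \<eta>)) \<and>
     (\<exists>ts. set ts \<subseteq> T \<and> s 0 = blocks (map enc ts)) \<and>
     (\<exists>X js ks ls c c' w. grounded T H \<nu> X \<and> card X + length (s 2) \<le> n \<and>
        set js \<union> set ks \<union> set ls \<subseteq> insert 0 X \<and>
        s 6 = blocks (map binary js) \<and> s 7 = blocks (map (\<lambda>j. rev (binary j)) ks) \<and>
        s 8 = blocks (map binary ls) @ map Bit c @ [Sep] \<and>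
        (s 9 = [] \<or> s 9 = map Bit c @ [Sep]) \<and>
        s 4 = map Bit c' @ Sep # w \<and> (c' = [] \<or> c' = c) \<and>
        (w = [Sep] \<or> w \<in> (\<lambda>\<alpha>. map Bit (enc \<alpha>)) ` T))"

lemma sound_storeI:
  assumes "s 3 = rev (map Bit (enc \<eta>))" and "set ts \<subseteq> T" and "s 0 = blocks (map enc ts)"
    and "grounded T H \<nu> X" and "card X + length (s 2) \<le> n"
    and "set js \<subseteq> insert 0 X" and "set ks \<subseteq> insert 0 X" and "set ls \<subseteq> insert 0 X"
    and "s 6 = blocks (map binary js)" and "s 7 = blocks (map (\<lambda>j. rev (binary j)) ks)"
    and "s 8 = blocks (map binary ls) @ map Bit c @ [Sep]"
    and "s 9 = [] \<or> s 9 = map Bit c @ [Sep]"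
    and "s 4 = map Bit c' @ Sep # w" and "c' = [] \<or> c' = c"
    and "w = [Sep] \<or> w \<in> (\<lambda>\<alpha>. map Bit (enc \<alpha>)) ` T"
  shows "sound_store enc T \<eta> H \<nu> n s"
proof -
  have "set js \<union> set ks \<union> set ls \<subseteq> insert 0 X"
    using assms(6-8) by blast
  with assms show ?thesis
    unfolding sound_store_def by blast
qed

text \<open>An empty stack delivers the empty word, which is \<open>binary 0\<close>; this is where
  the extra index 0 comes from.\<close>

lemma zipper_pop:
  obtains k ks' where "rev (head_word (blocks (map (\<lambda>j. rev (binary j)) ks))) = map Bit (binary k)"
    "rest_words (blocks (map (\<lambda>j. rev (binary j)) ks)) = blocks (map (\<lambda>j. rev (binary j)) ks')"
    "insert k (set ks') \<subseteq> insert 0 (set ks)"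
proof (cases ks)
  case Nil
  then show thesis
    using that[of 0 "[]"] by simp
next
  case (Cons k ks')
  then show thesis
    using that[of k ks'] by (auto simp flip: rev_map)
qed

lemma zipper_push:
  obtains j js' where "rev (head_word (blocks (map binary js))) = map Bit (rev (binary j))"
    "rest_words (blocks (map binary js)) = blocks (map binary js')"
    "insert j (set js') \<subseteq> insert 0 (set js)"
proof (cases js)
  case Nil
  then show thesis
    using that[of 0 "[]"] by simp
next
  case (Cons j js')
  then show thesis
    using that[of j js'] by (auto simp: rev_map)
qed

text \<open>Stacks 4, 8 and 9 name the same candidate unless its index is missing there, so a
  positive answer justifies the vertex that is added. A positive label answer also excludes the
  placeholder \<open>[Sep]\<close>; then \<open>w\<close> encodes an axiom, and injectivity of
  \<open>enc\<close> turns equal words into equal sentences.\<close>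

lemma sound_store_add:
  fixes L :: "('m, 'a) logic" and enc :: "'a \<Rightarrow> bool list" and H :: "('v, 'a) hypergraph"
    and \<nu> :: "nat \<Rightarrow> 'v"
  defines "Q \<equiv> access_answer L enc H \<nu>"
  assumes inj: "inj_on enc (sentences L)" and T: "finite_theory L T"
    and s: "sound_store enc T \<eta> H \<nu> n s"
  shows "sound_store enc T \<eta> H \<nu> n (effect Q Add s)"
proof (cases "(Q Is_Hyperedge (s 8) \<or> Q Has_Label (s 4)) \<and> s 2 \<noteq> []")
  case False
  with s show ?thesis
    by auto
next
  case True
  obtain X js ks ls c c' w where X: "grounded T H \<nu> X" and card: "card X + length (s 2) \<le> n"
    and sub: "set js \<union> set ks \<union> set ls \<subseteq> insert 0 X"
    and s6: "s 6 = blocks (map binary js)" and s7: "s 7 = blocks (map (\<lambda>j. rev (binary j)) ks)"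
    and s8: "s 8 = blocks (map binary ls) @ map Bit c @ [Sep]"
    and s9: "s 9 = [] \<or> s 9 = map Bit c @ [Sep]"
    and s4: "s 4 = map Bit c' @ Sep # w" "c' = [] \<or> c' = c"
    and w: "w = [Sep] \<or> w \<in> (\<lambda>\<alpha>. map Bit (enc \<alpha>)) ` T"
    using s unfolding sound_store_def by blast
  obtain ts where ts: "set ts \<subseteq> T" "s 0 = blocks (map enc ts)"
    using s unfolding sound_store_def by blast
  have s3: "s 3 = rev (map Bit (enc \<eta>))"
    using s by (simp add: sound_store_def)
  have "\<exists>i\<in>{1..card (verts H)}. c = binary i \<and>
      (lab H (\<nu> i) \<in> T \<or> (\<exists>S\<subseteq>X. (\<nu> ` S, \<nu> i) \<in> hedges H))"
  proof (cases "Q Is_Hyperedge (s 8)")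
    case True
    then obtain i where i: "i \<in> {1..card (verts H)}" "c = binary i"
      and ls: "set ls \<subseteq> {1..card (verts H)}" "(\<nu> ` set ls, \<nu> i) \<in> hedges H"
      unfolding Q_def s8 access_hyperedge_iff by blast
    \<comment> \<open>The oracle confirms that all premises are genuine indices, which rules out
      0.\<close>
    from ls(1) sub have "set ls \<subseteq> X"
      by fastforce
    with i ls(2) show ?thesis
      by blast
  next
    case False
    with True have "Q Has_Label (s 4)"
      by blast
    then obtain i where i: "i \<in> {1..card (verts H)}" "c' = binary i"
      and l: "lab H (\<nu> i) \<in> sentences L" "w = map Bit (enc (lab H (\<nu> i)))"
      unfolding Q_def s4(1) access_label_iff by blast
    \<comment> \<open>A positive number has a nonempty numeral, so \<open>c'\<close> is not empty
      and must be the current candidate.\<close>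
    from i s4(2) have "c = binary i"
      by auto
    moreover have "w \<noteq> [Sep]"
      using l(2) by auto
    with w l obtain \<alpha> where "\<alpha> \<in> T" "map Bit (enc \<alpha>) = map Bit (enc (lab H (\<nu> i)))"
      by auto
    then have "\<alpha> \<in> T" "enc \<alpha> = enc (lab H (\<nu> i))"
      by (auto simp: inj_map_eq_map inj_def)
    then have "lab H (\<nu> i) \<in> T"
      using T l(1) inj by (metis finite_theory_def inj_onD subsetD)
    ultimately show ?thesis
      using i by blast
  qed
  then obtain i where i: "i \<in> {1..card (verts H)}" "c = binary i"
    "lab H (\<nu> i) \<in> T \<or> (\<exists>S\<subseteq>X. (\<nu> ` S, \<nu> i) \<in> hedges H)"
    by blast
  \<comment> \<open>After an \<open>Add\<close> stack 9 is empty, so a repeated \<open>Add\<close>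
    pushes the index 0. The answer still justifies \<open>i\<close>, so \<open>insert i X\<close>
    works in both cases, and the budget has paid for it.\<close>
  define k where "k = (if s 9 = [] then 0 else i)"
  have head: "rev (head_word (s 9)) = map Bit (rev (binary k))" and rest: "rest_words (s 9) = []"
    using s9 i(2) by (auto simp: k_def rev_map)
  have "grounded T H \<nu> (insert i X)"
    by (rule grounded_insert[OF X i(1,3)])
  moreover have "card (insert i X) + length (tl (s 2)) \<le> n"
    using card True card_insert_le_m1[of "Suc (card X)" X i] by (cases "s 2") (auto simp: le_SucI)
  moreover have "set js \<union> set (k # ks) \<union> set ls \<subseteq> insert 0 (insert i X)"
    using sub by (auto simp: k_def)
  moreover have "rev (head_word (s 9)) @ Sep # s 7 = blocks (map (\<lambda>j. rev (binary j)) (k # ks))"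
    by (simp add: head s7)
  moreover have "effect Q Add s =
      s(2 := tl (s 2), 9 := [], 7 := rev (head_word (s 9)) @ Sep # s 7)"
    using True rest by (auto simp: fun_eq_iff)
  ultimately show ?thesis
    using ts s3 s6 s8 s4 w
    by (intro sound_storeI[where ts = ts and X = "insert i X" and js = js and ks = "k # ks" and
          ls = ls and c = c and c' = c' and w = w]) (simp_all del: effect.simps)
qed

text \<open>The remaining certificate \<open>y\<close> is arbitrary: what \<open>Begin\<close> reads
  is a mere guess, and only an oracle answer lets a vertex enter \<open>X\<close>.\<close>

lemma sound_store_effect:
  fixes L :: "('m, 'a) logic" and enc :: "'a \<Rightarrow> bool list" and H :: "('v, 'a) hypergraph"
    and \<nu> :: "nat \<Rightarrow> 'v"
  defines "Q \<equiv> access_answer L enc H \<nu>"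
  assumes inj: "inj_on enc (sentences L)" and T: "finite_theory L T"
    and s: "sound_store enc T \<eta> H \<nu> n s"
  shows "sound_store enc T \<eta> H \<nu> n (effect Q i (s(1 := y)))"
proof -
  let ?s = "s(1 := y)"
  have s': "sound_store enc T \<eta> H \<nu> n ?s"
    using s by (simp add: sound_store_def)
  obtain ts where ts: "set ts \<subseteq> T" "s 0 = blocks (map enc ts)"
    using s unfolding sound_store_def by blast
  obtain X js ks ls c c' w where X: "grounded T H \<nu> X" and card: "card X + length (s 2) \<le> n"
    and sub: "set js \<union> set ks \<union> set ls \<subseteq> insert 0 X"
    and s6: "s 6 = blocks (map binary js)" and s7: "s 7 = blocks (map (\<lambda>j. rev (binary j)) ks)"
    and s8: "s 8 = blocks (map binary ls) @ map Bit c @ [Sep]"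
    and s9: "s 9 = [] \<or> s 9 = map Bit c @ [Sep]"
    and s4: "s 4 = map Bit c' @ Sep # w" "c' = [] \<or> c' = c"
    and w: "w = [Sep] \<or> w \<in> (\<lambda>\<alpha>. map Bit (enc \<alpha>)) ` T"
    using s unfolding sound_store_def by blast
  have s3: "s 3 = rev (map Bit (enc \<eta>))"
    using s by (simp add: sound_store_def)
  note common = X card s3 ts
  show ?thesis
  proof (cases i)
    case Left
    obtain k ks' where k: "rev (head_word (s 7)) = map Bit (binary k)"
      "rest_words (s 7) = blocks (map (\<lambda>j. rev (binary j)) ks')"
      "insert k (set ks') \<subseteq> insert 0 (set ks)"
      unfolding s7 by (rule zipper_pop)
    show ?thesis
      unfolding Left
      by (rule sound_storeI[where ts = ts and X = X and js = "k # js" and ks = ks' and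
            ls = ls and c = c and c' = c' and w = w])
        (use common sub k s6 s8 s9 s4 w in auto)
  next
    case Copy
    obtain k ks' where k: "rev (head_word (s 7)) = map Bit (binary k)"
      "rest_words (s 7) = blocks (map (\<lambda>j. rev (binary j)) ks')"
      "insert k (set ks') \<subseteq> insert 0 (set ks)"
      unfolding s7 by (rule zipper_pop)
    show ?thesis
      unfolding Copy
      by (rule sound_storeI[where ts = ts and X = X and js = "k # js" and ks = ks' and
            ls = "k # ls" and c = c and c' = c' and w = w])
        (use common sub k s6 s8 s9 s4 w in auto)
  next
    case Right
    obtain j js' where j: "rev (head_word (s 6)) = map Bit (rev (binary j))"
      "rest_words (s 6) = blocks (map binary js')"
      "insert j (set js') \<subseteq> insert 0 (set js)"
      unfolding s6 by (rule zipper_push)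
    show ?thesis
      unfolding Right
      by (rule sound_storeI[where ts = ts and X = X and js = js' and ks = "j # ks" and
            ls = ls and c = c and c' = c' and w = w])
        (use common sub j s7 s8 s9 s4 w in auto)
  next
    case Next
    show ?thesis
    proof (cases ts)
      case Nil
      with ts s' show ?thesis
        by (simp add: Next)
    next
      case (Cons t ts')
      \<comment> \<open>\<open>Next\<close> removes the candidate from the label query, hence the
        witness \<open>[]\<close> for \<open>c'\<close> below.\<close>
      have e: "effect Q Next ?s = ?s(0 := blocks (map enc ts'), 4 := Sep # map Bit (enc t))"
        using ts(2) Cons by (auto simp: fun_eq_iff)
      show ?thesis
        unfolding Next e sound_store_def
        by (intro conjI exI[of _ ts'] exI[of _ X] exI[of _ js] exI[of _ ks] exI[of _ ls]
            exI[of _ c] exI[of _ "[]"] exI[of _ "map Bit (enc t)"])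
          (use common sub s6 s7 s8 s9 Cons in auto)
    qed
  next
    case Begin
    obtain b where "head_word y = map Bit b"
      using head_word_is_bits by blast
    then have b: "rev (head_word y) = map Bit (rev b)"
      by (simp add: rev_map)
    show ?thesis
      unfolding Begin
      by (rule sound_storeI[where ts = ts and X = X and js = js and ks = ks and
            ls = "[]" and c = "rev b" and c' = "rev b" and w = w])
        (use common sub s6 s7 s4 w b in auto)
  next
    case Add
    then show ?thesis
      unfolding Q_def using sound_store_add[OF inj T s'] by blast
  qed
qed

text \<open>The index on top of stack 7 may be 0, but a positive label answer excludes this, so it
  lies in \<open>X\<close>.\<close>

lemma sound_store_goal:
  assumes "sound_store enc T \<eta> H \<nu> n s" and "inj_on enc (sentences L)" and "\<eta> \<in> sentences L"
    and "access_answer L enc H \<nu> Has_Label (rev (head_word (s 7)) @ Sep # map Bit (enc \<eta>))"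
  shows "\<exists>X g. grounded T H \<nu> X \<and> g \<in> X \<and> lab H (\<nu> g) = \<eta> \<and> card X \<le> n"
proof -
  obtain X ks where X: "grounded T H \<nu> X" "card X \<le> n" "set ks \<subseteq> insert 0 X"
    and s7: "s 7 = blocks (map (\<lambda>j. rev (binary j)) ks)"
    using assms(1) unfolding sound_store_def by (metis add_leD1 le_sup_iff)
  obtain k where k: "rev (head_word (s 7)) = map Bit (binary k)" "k \<in> insert 0 X"
    using zipper_pop[of ks] X(3) unfolding s7 by (metis insert_subset subset_insertI subset_trans insert_absorb2 insert_mono)
  from assms(4) obtain i where i: "i \<in> {1..card (verts H)}" "binary k = binary i"
    "lab H (\<nu> i) \<in> sentences L" "map Bit (enc \<eta>) = map Bit (enc (lab H (\<nu> i)))"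
    unfolding k(1) access_label_iff by blast
  from i(2) have "k = i"
    by (rule binary_inj)
  with i(1) k(2) have "i \<in> X"
    by auto
  moreover have "enc \<eta> = enc (lab H (\<nu> i))"
    using i(4) by (simp add: inj_map_eq_map inj_def)
  with assms(2,3) i(3) have "lab H (\<nu> i) = \<eta>"
    by (metis inj_onD)
  ultimately show ?thesis
    using X by blast
qed

lemma exec_check_goal:
  assumes "s 3 = rev (map Bit b)"
  shows "\<exists>t s'. exec Q check_goal s t s' \<and>
    t \<le> 2 * length (s 4) + 4 * length (s 3) + 4 * length (s 7) + 11 \<and>
    (accepting s' \<longleftrightarrow> Q Has_Label (rev (head_word (s 7)) @ Sep # map Bit b))"
proof -
  define s1 where "s1 = s(4 := [])"
  define s2 where "s2 = s1(3 := [], 4 := map Bit b)"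
  define s3 where "s3 = s2(7 := rest_words (s 7), 4 := rev (head_word (s 7)) @ Sep # map Bit b)"
  define a where "a = Q Has_Label (rev (head_word (s 7)) @ Sep # map Bit b)"
  have s3b: "s 3 = map Bit (rev b)"
    using assms by (simp add: rev_map)
  have 1: "\<exists>t\<le>2 * length (s 4) + 1. exec Q (clear 4) s t s1"
    by (rule exec_clear_effect[of s1 s 4]) (simp add: s1_def)
  have 2: "\<exists>t\<le>(length [4 :: nat] + 3) * (length (s1 3) + 1). exec Q (move_bits 3 [4]) s1 t s2"
    by (rule exec_move_bits_effect) (auto simp: s2_def s1_def s3b rev_map)
  have 3: "\<exists>t\<le>(length [4 :: nat] + 3) * (length (s2 7) + 1). exec Q (move_word 7 [4]) s2 t s3"
    by (rule exec_move_word_effect) (auto simp: s3_def s2_def s1_def)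
  have "exec Q (if Q Has_Label (s3 4) then Push 0 (Bit True) else Push 0 (Bit False)) s3 1
      (s3(0 := Bit a # s3 0))"
    using Push[of Q 0 "Bit a" s3] by (auto simp: a_def s3_def)
  then have "\<exists>t\<le>1. exec Q (if Q Has_Label (s3 4) then Push 0 (Bit True) else Push 0 (Bit False))
      s3 t (s3(0 := Bit a # s3 0))"
    by blast
  from exec_Seq_bound[OF 1 exec_Seq_bound[OF 2 exec_Seq_bound[OF 3 exec_Ask_bound[OF this]]]]
  obtain t where "exec Q check_goal s t (s3(0 := Bit a # s3 0))"
    and "t \<le> 2 * length (s 4) + 1 + ((length [4 :: nat] + 3) * (length (s1 3) + 1) +
      ((length [4 :: nat] + 3) * (length (s2 7) + 1) + (1 + 1)))"
    unfolding check_goal_def by blast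
  moreover have "accepting (s3(0 := Bit a # s3 0)) \<longleftrightarrow> a"
    by (simp add: accepting_def top_of_def)
  moreover have "length (s1 3) = length (s 3)" "length (s2 7) = length (s 7)"
    by (simp_all add: s1_def s2_def)
  ultimately show ?thesis
    unfolding a_def[symmetric]
    by (intro exI[of _ t] exI[of _ "s3(0 := Bit a # s3 0)"] conjI) simp_all
qed

section \<open>Runs of the whole verifier\<close>

definition ready :: "nat \<Rightarrow> bool list \<Rightarrow> bool list list \<Rightarrow> word \<Rightarrow> store" where
  "ready n b bs y = (\<lambda>_. [])(0 := blocks bs, 1 := y, 2 := replicate n (Bit True),
     3 := rev (map Bit b), 4 := [Sep, Sep], 8 := [Sep])"

lemma exec_prepare:
  fixes w :: word
  assumes w: "w = replicate n (Bit True) @ [Sep] @ map Bit b @ [Sep] @ blocks bs"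
  shows "\<exists>t\<le>8 * length w + 13. exec Q prepare (initial w y) t (ready n b bs y)"
proof -
  define s where "s = initial w y"
  define w1 where "w1 = map Bit b @ Sep # blocks bs"
  define s1 where "s1 = s(0 := Sep # w1, 2 := replicate n (Bit True))"
  define s2 where "s2 = s1(0 := w1)"
  define s3 where "s3 = s2(0 := Sep # blocks bs, 3 := rev (map Bit b))"
  define s4 where "s4 = s3(0 := blocks bs)"
  define s5 where "s5 = s4(4 := [Sep])"
  define s6 where "s6 = s5(4 := [Sep, Sep])"
  have s0: "s 0 = map Bit (replicate n True) @ Sep # w1"
    using w by (simp add: s_def initial_def w1_def)
  have head: "head_word (s 0) = replicate n (Bit True)"
      "dropWhile (\<lambda>x. x \<noteq> Sep) (s 0) = Sep # w1"
    using head_word_Bit[of "replicate n True" w1] dropWhile_Bit[of "replicate n True" w1]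
    by (simp_all add: s0)
  have empty: "s 2 = []" "s 3 = []" "s 4 = []" "s 8 = []"
    by (simp_all add: s_def initial_def)
  have 1: "\<exists>t\<le>(length [2 :: nat] + 3) * (length (s 0) + 1). exec Q (move_bits 0 [2]) s t s1"
    by (rule exec_move_bits_effect)
      (auto simp: s1_def head empty)
  have 2: "\<exists>t\<le>1. exec Q (Pop 0) s1 t s2"
    by (rule exec_Pop_bound) (auto simp: s2_def s1_def)
  have 3: "\<exists>t\<le>(length [3 :: nat] + 3) * (length (s2 0) + 1). exec Q (move_bits 0 [3]) s2 t s3"
    by (rule exec_move_bits_effect) (auto simp: s3_def s2_def s1_def w1_def empty)
  have 4: "\<exists>t\<le>1. exec Q (Pop 0) s3 t s4"
    by (rule exec_Pop_bound) (auto simp: s4_def s3_def)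
  have 5: "\<exists>t\<le>1. exec Q (Push 4 Sep) s4 t s5"
    by (rule exec_Push_bound) (auto simp: s5_def s4_def s3_def s2_def s1_def empty)
  have 6: "\<exists>t\<le>1. exec Q (Push 4 Sep) s5 t s6"
    by (rule exec_Push_bound) (auto simp: s6_def s5_def)
  have "ready n b bs y = s6(8 := Sep # s6 8)"
    by (auto simp: fun_eq_iff ready_def s6_def s5_def s4_def s3_def s2_def s1_def s_def initial_def)
  then have 7: "\<exists>t\<le>1. exec Q (Push 8 Sep) s6 t (ready n b bs y)"
    by (rule exec_Push_bound)
  have "length (s2 0) \<le> length w" "length (s 0) = length w"
    using w by (simp_all add: s2_def w1_def s_def initial_def)
  with exec_Seq_bound[OF 1 exec_Seq_bound[OF 2 exec_Seq_bound[OF 3 exec_Seq_bound[OF 4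
    exec_Seq_bound[OF 5 exec_Seq_bound[OF 6 7]]]]]]
  show ?thesis
    unfolding prepare_def s_def by (elim exec_bound_mono) simp
qed

lemma sound_store_ready: "set ts \<subseteq> T \<Longrightarrow> sound_store enc T \<eta> H \<nu> n (ready n (enc \<eta>) (map enc ts) y)"
  by (rule sound_storeI[where ts = ts and X = "{}" and js = "[]" and ks = "[]" and ls = "[]" and
        c = "[]" and c' = "[]" and w = "[Sep]"]) (auto simp: ready_def grounded_empty)

lemma small_store_ready:
  assumes "length (blocks bs) + length b + length y \<le> N"
  shows "small_store N (ready n b bs y)"
proof -
  have "k * length y + k \<le> k * (N + 1)" for k
    using mult_le_mono2[of "length y + 1" "N + 1" k] assms by simp
  from this[of "N + 1"] this[of "2 * N + 3"]
  have a: "1 + (N + 1) * length y \<le> (N + 1) * (N + 1)"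
    and b: "2 + (2 * N + 3) * length y \<le> (2 * N + 3) * (N + 1)"
    by linarith+
  have lengths: "ready n b bs y 5 = []" "length (ready n b bs y 0) = length (blocks bs)"
      "ready n b bs y 1 = y" "length (ready n b bs y 3) = length b" "ready n b bs y 6 = []"
      "ready n b bs y 7 = []" "ready n b bs y 9 = []" "length (ready n b bs y 8) = 1"
      "length (ready n b bs y 4) = 2"
    by (simp_all add: ready_def)
  show ?thesis
    unfolding small_store_def lengths
    by (intro conjI; (use assms in \<open>simp; fail\<close> | rule a | rule b))
qed

text \<open>The main loop contributes the first product and 1, the goal check at most
  \<open>2 * (2 * N + 3) * (N + 1) + 8 * N + 11\<close>, the preparation at most
  \<open>8 * N + 13\<close>.\<close>

definition time_bound :: "nat \<Rightarrow> nat" where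
  "time_bound N = N * (12 * (2 * N + (N + 1) * (N + 1) + (2 * N + 3) * (N + 1) + 1) + 7) +
     2 * (2 * N + 3) * (N + 1) + 16 * N + 25"

text \<open>Nothing is assumed about \<open>y\<close>: one run shows halting and soundness. Speaking
  of a single run is enough because execution is deterministic.\<close>

lemma exec_verifier:
  fixes L :: "('m, 'a) logic" and enc :: "'a \<Rightarrow> bool list" and H :: "('v, 'a) hypergraph"
    and \<nu> :: "nat \<Rightarrow> 'v"
  defines "Q \<equiv> access_answer L enc H \<nu>"
  assumes inj: "inj_on enc (sentences L)" and T: "finite_theory L T" and \<eta>: "\<eta> \<in> sentences L"
    and w: "w = replicate n (Bit True) @ [Sep] @ map Bit (enc \<eta>) @ [Sep] @ blocks (map enc ts)"
    and ts: "set ts \<subseteq> T"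
  shows "\<exists>t s'. exec Q verifier (initial w y) t s' \<and> t \<le> time_bound (length w + length y) \<and>
    (accepting s' \<longrightarrow> (\<exists>X g. grounded T H \<nu> X \<and> g \<in> X \<and> lab H (\<nu> g) = \<eta> \<and> card X \<le> n))"
proof -
  define N where "N = length w + length y"
  let ?r = "ready n (enc \<eta>) (map enc ts) y"
  have "small_store N ?r"
    by (rule small_store_ready) (simp add: w N_def)
  from exec_main_loop[where Q = Q and P = "sound_store enc T \<eta> H \<nu> n",
      OF this sound_store_ready[OF ts] sound_store_effect[where H = H and \<nu> = \<nu>, OF inj T, folded Q_def]]
  obtain t2 s where t2: "exec Q main_loop ?r t2 s"
    "t2 \<le> length (?r 1) *
      (12 * (2 * N + (N + 1) * (N + 1) + (2 * N + 3) * (N + 1) + 1) + 7) + 1"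
    "small_store N s" "sound_store enc T \<eta> H \<nu> n s"
    by blast
  obtain t1 where t1: "exec Q prepare (initial w y) t1 ?r" "t1 \<le> 8 * length w + 13"
    using exec_prepare[OF w, of Q y] by blast
  have "s 3 = rev (map Bit (enc \<eta>))"
    using t2(4) by (simp add: sound_store_def)
  from exec_check_goal[of s "enc \<eta>" Q, OF this] obtain t3 s' where t3: "exec Q check_goal s t3 s'"
    "t3 \<le> 2 * length (s 4) + 4 * length (s 3) + 4 * length (s 7) + 11"
    "accepting s' \<longleftrightarrow> Q Has_Label (rev (head_word (s 7)) @ Sep # map Bit (enc \<eta>))"
    by blast
  have "exec Q verifier (initial w y) (t1 + (t2 + t3)) s'"
    unfolding verifier_def by (rule Seq[OF t1(1) Seq[OF t2(1) t3(1)]])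
  moreover have "t1 + (t2 + t3) \<le> time_bound N"
  proof -
    have "length (?r 1) \<le> N"
      by (simp add: ready_def N_def)
    then have "length (?r 1) * (12 * (2 * N + (N + 1) * (N + 1) + (2 * N + 3) * (N + 1) + 1) + 7) \<le>
        N * (12 * (2 * N + (N + 1) * (N + 1) + (2 * N + 3) * (N + 1) + 1) + 7)"
      by (rule mult_right_mono) simp
    moreover have "length (s 3) \<le> N" "length (s 7) \<le> N"
      using t2(3) by (simp_all add: small_store_def)
    moreover have "length (s 4) \<le> (2 * N + 3) * (N + 1)"
      using t2(3) unfolding small_store_def by (blast dest: add_leD1)
    moreover have "length w \<le> N"
      by (simp add: N_def)
    ultimately show ?thesis
      using t1(2) t2(2) t3(2) unfolding time_bound_def mult.assoc by linarith
  qed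
  moreover have "accepting s' \<longrightarrow>
      (\<exists>X g. grounded T H \<nu> X \<and> g \<in> X \<and> lab H (\<nu> g) = \<eta> \<and> card X \<le> n)"
    using t3(3) sound_store_goal[OF t2(4) inj \<eta>] unfolding Q_def by blast
  ultimately show ?thesis
    unfolding N_def by blast
qed

section \<open>Completeness\<close>

text \<open>Acceptance is carried backwards along \<open>instr_step\<close>. Time is ignored here,
  since \<open>exec_verifier\<close> bounds it for every certificate.\<close>

definition accepts_from :: "(access \<Rightarrow> word \<Rightarrow> bool) \<Rightarrow> store \<Rightarrow> bool" where
  "accepts_from Q s \<longleftrightarrow> (\<exists>t s'. exec Q (Seq main_loop check_goal) s t s' \<and> accepting s')"

definition instr_step :: "(access \<Rightarrow> word \<Rightarrow> bool) \<Rightarrow> store \<Rightarrow> store \<Rightarrow> bool" where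
  "instr_step Q s s' \<longleftrightarrow> (\<exists>i w. s 1 = code i @ w \<and> s 5 = [] \<and> s' = effect Q i (s(1 := w)))"

lemma instr_stepI: "s 1 = code i @ w \<Longrightarrow> s 5 = [] \<Longrightarrow> instr_step Q s (effect Q i (s(1 := w)))"
  unfolding instr_step_def by blast

lemma accepts_from_steps:
  assumes "(instr_step Q)\<^sup>*\<^sup>* s s'" and "accepts_from Q s'"
  shows "accepts_from Q s"
  using assms
proof (induction rule: converse_rtranclp_induct)
  case (step s s1)
  then obtain i w where i: "s 1 = code i @ w" "s 5 = []" "s1 = effect Q i (s(1 := w))"
    unfolding instr_step_def by blast
  from step obtain t1 s2 t2 s' where "exec Q main_loop s1 t1 s2" "exec Q check_goal s2 t2 s'"
    and acc: "accepting s'"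
    unfolding accepts_from_def by (blast elim: exec_SeqE)
  with exec_main_loop_step[OF i(1,2)] i(3) obtain t where "exec Q main_loop s t s2"
    by blast
  from Seq[OF this \<open>exec Q check_goal s2 t2 s'\<close>] acc show ?case
    unfolding accepts_from_def by blast
qed

text \<open>Of the copied premises only the set is tracked, as in the hyperedge query. The vertices
  \<open>us\<close> stay on stack 7, which lets a walk stop in front of the goal vertex.\<close>

lemma copy_steps:
  assumes "s 1 = concat (map (\<lambda>x. code (if x \<in> S then Copy else Left)) xs) @ y" and "s 5 = []"
    and "s 7 = blocks (map (\<lambda>j. rev (binary j)) (xs @ us))" and "s 6 = blocks (map binary zs)"
    and "s 8 = blocks (map binary ls) @ w"
  shows "\<exists>ls'. set ls' = set ls \<union> set xs \<inter> S \<and> (instr_step Q)\<^sup>*\<^sup>* s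
    (s(1 := y, 6 := blocks (map binary (rev xs @ zs)), 7 := blocks (map (\<lambda>j. rev (binary j)) us),
       8 := blocks (map binary ls') @ w))"
  using assms
proof (induction xs arbitrary: s zs ls)
  case Nil
  then have eq: "s(1 := y, 6 := blocks (map binary (rev [] @ zs)),
      7 := blocks (map (\<lambda>j. rev (binary j)) us), 8 := blocks (map binary ls) @ w) = s"
    by (auto simp: fun_eq_iff)
  show ?case
    by (intro exI[of _ ls] conjI) (simp, simp only: eq rtranclp.rtrancl_refl)
next
  case (Cons x xs)
  define i where "i = (if x \<in> S then Copy else Left)"
  define v where "v = concat (map (\<lambda>x. code (if x \<in> S then Copy else Left)) xs) @ y"
  define s1 where "s1 = effect Q i (s(1 := v))"
  define ls1 where "ls1 = (if x \<in> S then x # ls else ls)"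
  have step: "instr_step Q s s1"
    unfolding s1_def by (rule instr_stepI) (use Cons.prems in \<open>simp_all add: i_def v_def\<close>)
  have "rev (head_word (s 7)) = map Bit (binary x)"
    "rest_words (s 7) = blocks (map (\<lambda>j. rev (binary j)) (xs @ us))"
    using Cons.prems(3) by (simp_all flip: rev_map)
  then have s1: "s1 = s(1 := v, 6 := blocks (map binary (x # zs)),
      7 := blocks (map (\<lambda>j. rev (binary j)) (xs @ us)), 8 := blocks (map binary ls1) @ w)"
    using Cons.prems(4,5) by (auto simp: s1_def i_def ls1_def fun_eq_iff)
  have "\<exists>ls'. set ls' = set ls1 \<union> set xs \<inter> S \<and> (instr_step Q)\<^sup>*\<^sup>* s1
    (s1(1 := y, 6 := blocks (map binary (rev xs @ (x # zs))),
       7 := blocks (map (\<lambda>j. rev (binary j)) us), 8 := blocks (map binary ls') @ w))"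
    by (rule Cons.IH) (use Cons.prems(2) in \<open>simp_all add: s1 v_def\<close>)
  then obtain ls' where "set ls' = set ls1 \<union> set xs \<inter> S" and steps: "(instr_step Q)\<^sup>*\<^sup>* s1
    (s1(1 := y, 6 := blocks (map binary (rev xs @ (x # zs))),
       7 := blocks (map (\<lambda>j. rev (binary j)) us), 8 := blocks (map binary ls') @ w))"
    by blast
  then have "set ls' = set ls \<union> set (x # xs) \<inter> S"
    by (auto simp: ls1_def)
  moreover have "s1(1 := y, 6 := blocks (map binary (rev xs @ (x # zs))),
       7 := blocks (map (\<lambda>j. rev (binary j)) us), 8 := blocks (map binary ls') @ w) =
     s(1 := y, 6 := blocks (map binary (rev (x # xs) @ zs)),
       7 := blocks (map (\<lambda>j. rev (binary j)) us), 8 := blocks (map binary ls') @ w)"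
    unfolding s1 by auto
  ultimately show ?case
    using converse_rtranclp_into_rtranclp[OF step steps] by metis
qed

text \<open>The pass over stack 7 is undone before \<open>Add\<close>, so that the next walk sees
  all derived vertices again.\<close>

lemma rewind_steps:
  assumes "s 1 = concat (map (\<lambda>_. code Right) zs) @ y" and "s 5 = []"
    and "s 6 = blocks (map binary zs)" and "s 7 = blocks (map (\<lambda>j. rev (binary j)) ks)"
  shows "(instr_step Q)\<^sup>*\<^sup>* s (s(1 := y, 6 := [], 7 := blocks (map (\<lambda>j. rev (binary j)) (rev zs @ ks))))"
  using assms
proof (induction zs arbitrary: s ks)
  case Nil
  then have eq: "s(1 := y, 6 := [], 7 := blocks (map (\<lambda>j. rev (binary j)) (rev [] @ ks))) = s"
    by (auto simp: fun_eq_iff)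
  show ?case
    by (simp only: eq rtranclp.rtrancl_refl)
next
  case (Cons z zs)
  define v where "v = concat (map (\<lambda>_. code Right) zs) @ y"
  define s1 where "s1 = effect Q Right (s(1 := v))"
  have step: "instr_step Q s s1"
    unfolding s1_def by (rule instr_stepI) (use Cons.prems in \<open>simp_all add: v_def\<close>)
  have "rev (head_word (s 6)) = map Bit (rev (binary z))"
    "rest_words (s 6) = blocks (map binary zs)"
    using Cons.prems(3) by (simp_all add: rev_map)
  then have s1: "s1 = s(1 := v, 6 := blocks (map binary zs),
      7 := blocks (map (\<lambda>j. rev (binary j)) (z # ks)))"
    using Cons.prems(4) by (auto simp: s1_def fun_eq_iff)
  have steps: "(instr_step Q)\<^sup>*\<^sup>* s1
      (s1(1 := y, 6 := [], 7 := blocks (map (\<lambda>j. rev (binary j)) (rev zs @ (z # ks)))))"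
    by (rule Cons.IH) (use Cons.prems(2) in \<open>simp_all add: s1 v_def\<close>)
  have "s1(1 := y, 6 := [], 7 := blocks (map (\<lambda>j. rev (binary j)) (rev zs @ (z # ks)))) =
      s(1 := y, 6 := [], 7 := blocks (map (\<lambda>j. rev (binary j)) (rev (z # zs) @ ks)))"
    unfolding s1 by auto
  with converse_rtranclp_into_rtranclp[OF step steps] show ?case
    by (simp only:)
qed

text \<open>Stacks 8 and 9 and the index on stack 4 are left open, because \<open>Begin\<close>
  overwrites them. \<open>w\<close> is the current sentence and \<open>k\<close> the remaining
  budget.\<close>

definition config ::
    "('a \<Rightarrow> bool list) \<Rightarrow> 'a \<Rightarrow> 'a list \<Rightarrow> word \<Rightarrow> nat list \<Rightarrow> nat \<Rightarrow> word \<Rightarrow> store \<Rightarrow> bool" where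
  "config enc \<eta> ts w xs k y s \<longleftrightarrow> s 0 = blocks (map enc ts) \<and> s 1 = y \<and>
     s 2 = replicate k (Bit True) \<and> s 3 = rev (map Bit (enc \<eta>)) \<and> (\<exists>c. s 4 = map Bit c @ Sep # w) \<and>
     s 5 = [] \<and> s 6 = [] \<and> s 7 = blocks (map (\<lambda>j. rev (binary j)) xs)"

text \<open>The order of quantifiers matters: one \<open>y\<close> serves all stores of the
  configuration, so instructions can be prepended to it whatever they leave on the open
  stacks.\<close>

definition winnable ::
    "(access \<Rightarrow> word \<Rightarrow> bool) \<Rightarrow> ('a \<Rightarrow> bool list) \<Rightarrow> 'a \<Rightarrow> 'a list \<Rightarrow> word \<Rightarrow> nat list \<Rightarrow> nat \<Rightarrow> nat \<Rightarrow> bool"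
  where
  "winnable Q enc \<eta> ts w xs k b \<longleftrightarrow>
     (\<exists>y. length y \<le> b \<and> (\<forall>s. config enc \<eta> ts w xs k y s \<longrightarrow> accepts_from Q s))"

lemma winnable_mono: "winnable Q enc \<eta> ts w xs k b \<Longrightarrow> b \<le> b' \<Longrightarrow> winnable Q enc \<eta> ts w xs k b'"
  unfolding winnable_def using order_trans by blast

lemma winnable_next:
  assumes "winnable Q enc \<eta> ts (map Bit (enc t)) xs k b"
  shows "winnable Q enc \<eta> (t # ts) w xs k (b + 2)"
proof -
  obtain y where y: "length y \<le> b"
    "\<And>s. config enc \<eta> ts (map Bit (enc t)) xs k y s \<Longrightarrow> accepts_from Q s"
    using assms unfolding winnable_def by blast
  have "accepts_from Q s" if s: "config enc \<eta> (t # ts) w xs k (code Next @ y) s" for s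
  proof -
    have "instr_step Q s (effect Q Next (s(1 := y)))"
      by (rule instr_stepI) (use s in \<open>auto simp: config_def\<close>)
    moreover have "config enc \<eta> ts (map Bit (enc t)) xs k y (effect Q Next (s(1 := y)))"
      using s by (auto simp: config_def intro: exI[of _ "[]"])
    ultimately show ?thesis
      using y(2) accepts_from_steps by blast
  qed
  with y(1) show ?thesis
    unfolding winnable_def by (intro exI[of _ "code Next @ y"]) simp
qed

text \<open>\<open>Begin\<close> and \<open>Add\<close> take 2 symbols each, the index its bits and
  a \<open>Sep\<close>, and each earlier vertex 2 symbols on the way out and 1 on the way
  back.\<close>

lemma winnable_add:
  fixes L :: "('m, 'a) logic" and enc :: "'a \<Rightarrow> bool list" and H :: "('v, 'a) hypergraph"
    and \<nu> :: "nat \<Rightarrow> 'v"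
  defines "Q \<equiv> access_answer L enc H \<nu>"
  assumes win: "winnable Q enc \<eta> ts w (i # xs) k b"
    and i: "i \<in> {1..card (verts H)}" and xs: "set xs \<subseteq> {1..card (verts H)}"
    and just: "lab H (\<nu> i) \<in> sentences L \<and> w = map Bit (enc (lab H (\<nu> i))) \<or>
      S \<subseteq> set xs \<and> (\<nu> ` S, \<nu> i) \<in> hedges H"
  shows "winnable Q enc \<eta> ts w xs (Suc k) (b + (3 * length xs + length (binary i) + 5))"
proof -
  obtain y where y: "length y \<le> b" "\<And>s. config enc \<eta> ts w (i # xs) k y s \<Longrightarrow> accepts_from Q s"
    using win unfolding winnable_def by blast
  define y3 where "y3 = code Add @ y"
  define y2 where "y2 = concat (map (\<lambda>_. code Right) (rev xs)) @ y3"
  define y1 where "y1 = concat (map (\<lambda>x. code (if x \<in> S then Copy else Left)) xs) @ y2"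
  \<comment> \<open>The index is written most significant bit first, because
    \<open>move_word\<close> reverses it.\<close>
  define y0 where "y0 = code Begin @ map Bit (rev (binary i)) @ Sep # y1"
  have "length (concat (map (\<lambda>x. code (if x \<in> S then Copy else Left)) xs)) = 2 * length xs"
    by (induction xs) auto
  moreover have "length (concat (map (\<lambda>_. code Right) (rev xs))) = length xs"
    by (induction xs) auto
  ultimately have len: "length y0 \<le> b + (3 * length xs + length (binary i) + 5)"
    using y(1) by (simp add: y0_def y1_def y2_def y3_def)
  have "accepts_from Q s" if s: "config enc \<eta> ts w xs (Suc k) y0 s" for s
  proof -
    have s_simps: "s 0 = blocks (map enc ts)" "s 1 = y0" "s (Suc 0) = y0" "s 2 = replicate (Suc k) (Bit True)"
      "s 3 = rev (map Bit (enc \<eta>))" "s 5 = []" "s 6 = []" "s 7 = blocks (map (\<lambda>j. rev (binary j)) xs)"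
      using s by (auto simp: config_def)
    obtain c where s4: "s 4 = map Bit c @ Sep # w"
      using s unfolding config_def by blast
    define s1 where "s1 = effect Q Begin (s(1 := map Bit (rev (binary i)) @ Sep # y1))"
    have step1: "instr_step Q s s1"
      unfolding s1_def by (rule instr_stepI) (simp_all add: s_simps y0_def)
    have s1: "s1 = s(1 := y1, 4 := map Bit (binary i) @ Sep # w,
        8 := map Bit (binary i) @ [Sep], 9 := map Bit (binary i) @ [Sep])"
      by (auto simp: s1_def s4 fun_eq_iff rev_map)
    have "\<exists>ls. set ls = set [] \<union> set xs \<inter> S \<and> (instr_step Q)\<^sup>*\<^sup>* s1
      (s1(1 := y2, 6 := blocks (map binary (rev xs @ [])), 7 := blocks (map (\<lambda>j. rev (binary j)) []),
         8 := blocks (map binary ls) @ (map Bit (binary i) @ [Sep])))"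
      by (rule copy_steps) (simp_all add: s1 s_simps y1_def)
    then obtain ls where ls: "set ls = set xs \<inter> S" and step2: "(instr_step Q)\<^sup>*\<^sup>* s1
      (s1(1 := y2, 6 := blocks (map binary (rev xs)), 7 := [],
         8 := blocks (map binary ls) @ (map Bit (binary i) @ [Sep])))"
      by auto
    define s2 where "s2 = s1(1 := y2, 6 := blocks (map binary (rev xs)), 7 := [],
         8 := blocks (map binary ls) @ (map Bit (binary i) @ [Sep]))"
    have step3: "(instr_step Q)\<^sup>*\<^sup>* s2
      (s2(1 := y3, 6 := [], 7 := blocks (map (\<lambda>j. rev (binary j)) (rev (rev xs) @ []))))"
      by (rule rewind_steps) (simp_all add: s2_def s1 s_simps y2_def)
    define s3 where "s3 = s2(1 := y3, 6 := [], 7 := blocks (map (\<lambda>j. rev (binary j)) xs))"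
    have step4: "instr_step Q s3 (effect Q Add (s3(1 := y)))"
      by (rule instr_stepI) (simp_all add: s3_def s2_def s1 s_simps y3_def)
    have "Q Is_Hyperedge (s3 8) \<or> Q Has_Label (s3 4)"
    proof (cases "S \<subseteq> set xs \<and> (\<nu> ` S, \<nu> i) \<in> hedges H")
      case True
      then have "set ls = S"
        using ls by auto
      with True xs i have "Q Is_Hyperedge (blocks (map binary ls) @ map Bit (binary i) @ [Sep])"
        unfolding Q_def access_hyperedge_iff by blast
      then show ?thesis
        by (simp add: s3_def s2_def)
    next
      case False
      with just i have "Q Has_Label (map Bit (binary i) @ Sep # w)"
        unfolding Q_def access_label_iff by blast
      then show ?thesis
        by (simp add: s3_def s2_def s1)
    qed
    moreover have "s3 2 \<noteq> []"
      by (simp add: s3_def s2_def s1 s_simps)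
    ultimately have "effect Q Add (s3(1 := y)) = s3(1 := y, 2 := tl (s3 2), 9 := rest_words (s3 9),
        7 := rev (head_word (s3 9)) @ Sep # s3 7)"
      by auto
    then have "config enc \<eta> ts w (i # xs) k y (effect Q Add (s3(1 := y)))"
      by (auto simp: config_def s3_def s2_def s1 s_simps rev_map)
    from y(2)[OF this] have "accepts_from Q s3"
      using step4 accepts_from_steps by blast
    then have "accepts_from Q s2"
      using accepts_from_steps[OF step3] by (simp add: s3_def)
    then have "accepts_from Q s1"
      using accepts_from_steps[OF step2] by (simp add: s2_def)
    then show ?thesis
      using step1 accepts_from_steps by blast
  qed
  with len show ?thesis
    unfolding winnable_def by blast
qed

text \<open>One \<open>Left\<close> of 2 symbols for each vertex above \<open>g\<close>: an instance
  of \<open>copy_steps\<close> with nothing to copy.\<close>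

lemma winnable_goal:
  fixes L :: "('m, 'a) logic" and enc :: "'a \<Rightarrow> bool list" and H :: "('v, 'a) hypergraph"
    and \<nu> :: "nat \<Rightarrow> 'v"
  defines "Q \<equiv> access_answer L enc H \<nu>"
  assumes g: "g \<in> set xs" "g \<in> {1..card (verts H)}" "lab H (\<nu> g) = \<eta>" and \<eta>: "\<eta> \<in> sentences L"
  shows "winnable Q enc \<eta> ts w xs k (2 * length xs)"
proof -
  obtain xs1 xs2 where xs: "xs = xs1 @ g # xs2"
    using g(1) by (meson split_list)
  define y where "y = concat (map (\<lambda>x. code (if x \<in> {} then Copy else Left)) xs1)"
  have "length y = 2 * length xs1"
    unfolding y_def by (induction xs1) auto
  then have len: "length y \<le> 2 * length xs"
    by (simp add: xs)
  have "accepts_from Q s" if s: "config enc \<eta> ts w xs k y s" for s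
  proof -
    define s1 where "s1 ls = s(1 := [], 6 := blocks (map binary (rev xs1 @ [])),
        7 := blocks (map (\<lambda>j. rev (binary j)) (g # xs2)), 8 := blocks (map binary ls) @ s 8)" for ls
    have "\<exists>ls. set ls = set [] \<union> set xs1 \<inter> {} \<and> (instr_step Q)\<^sup>*\<^sup>* s (s1 ls)"
      unfolding s1_def by (rule copy_steps) (use s in \<open>simp_all add: config_def xs y_def\<close>)
    then obtain ls where steps: "(instr_step Q)\<^sup>*\<^sup>* s (s1 ls)"
      by blast
    have "(s1 ls) 3 = rev (map Bit (enc \<eta>))"
      using s by (simp add: config_def s1_def)
    from exec_check_goal[of "s1 ls" "enc \<eta>" Q, OF this] obtain t s' where
      check: "exec Q check_goal (s1 ls) t s'"
      and acc: "accepting s' \<longleftrightarrow> Q Has_Label (rev (head_word (s1 ls 7)) @ Sep # map Bit (enc \<eta>))"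
      by blast
    have "rev (head_word (s1 ls 7)) = map Bit (binary g)"
      by (simp add: s1_def flip: rev_map)
    moreover have "Q Has_Label (map Bit (binary g) @ Sep # map Bit (enc \<eta>))"
      unfolding Q_def access_label_iff using g \<eta> by blast
    ultimately have "accepting s'"
      using acc by simp
    moreover have "exec Q main_loop (s1 ls) 1 (s1 ls)"
      by (rule exec_main_loop_end) (simp add: s1_def)
    ultimately have "accepts_from Q (s1 ls)"
      unfolding accepts_from_def using Seq[OF _ check] by blast
    with steps show ?thesis
      by (rule accepts_from_steps)
  qed
  with len show ?thesis
    unfolding winnable_def by blast
qed

text \<open>With at most \<open>n\<close> listed vertices and indices of at most \<open>m\<close>
  bits, each addition costs at most \<open>3 * n + m + 5\<close>. All these vertices share the
  sentence \<open>t\<close> on stack 4, so no \<open>Next\<close> intervenes.\<close>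

lemma winnable_add_leaves:
  fixes L :: "('m, 'a) logic" and enc :: "'a \<Rightarrow> bool list" and H :: "('v, 'a) hypergraph"
    and \<nu> :: "nat \<Rightarrow> 'v"
  defines "Q \<equiv> access_answer L enc H \<nu>"
  assumes "winnable Q enc \<eta> ts (map Bit (enc t)) (rev as @ xs) k b"
    and "set as \<union> set xs \<subseteq> {1..card (verts H)}" and "\<forall>i\<in>set as. lab H (\<nu> i) = t"
    and "t \<in> sentences L" and "length as + length xs \<le> n"
    and "\<forall>i\<in>{1..card (verts H)}. length (binary i) \<le> m"
  shows "winnable Q enc \<eta> ts (map Bit (enc t)) xs (k + length as) (b + length as * (3 * n + m + 5))"
  using assms(2-)
proof (induction as arbitrary: xs)
  case (Cons i as)
  have "winnable Q enc \<eta> ts (map Bit (enc t)) (i # xs) (k + length as)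
      (b + length as * (3 * n + m + 5))"
    using Cons.prems by (intro Cons.IH) auto
  from winnable_add[OF this[unfolded Q_def], where S = "{}", folded Q_def] Cons.prems
  have "winnable Q enc \<eta> ts (map Bit (enc t)) xs (Suc (k + length as))
      (b + length as * (3 * n + m + 5) + (3 * length xs + length (binary i) + 5))"
    by auto
  moreover have "length (binary i) \<le> m" "length xs \<le> n"
    using Cons.prems by auto
  then have "b + length as * (3 * n + m + 5) + (3 * length xs + length (binary i) + 5) \<le>
      b + length (i # as) * (3 * n + m + 5)"
    by simp
  ultimately have "winnable Q enc \<eta> ts (map Bit (enc t)) xs (Suc (k + length as))
      (b + length (i # as) * (3 * n + m + 5))"
    by (rule winnable_mono)
  then show ?case
    by simp
qed simp

text \<open>A missing vertex of least rank can always be added: the axiom-labelled vertices are all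
  listed, so it has a justifying hyperedge, whose premises have smaller rank and hence are listed
  too.\<close>

lemma winnable_edges:
  fixes L :: "('m, 'a) logic" and enc :: "'a \<Rightarrow> bool list" and H :: "('v, 'a) hypergraph"
    and \<nu> :: "nat \<Rightarrow> 'v" and r :: "nat \<Rightarrow> nat"
  defines "Q \<equiv> access_answer L enc H \<nu>"
  assumes X: "X \<subseteq> {1..card (verts H)}" "card X \<le> n"
    and r: "\<And>i. i \<in> X \<Longrightarrow> lab H (\<nu> i) \<in> T \<or>
      (\<exists>S\<subseteq>X. (\<nu> ` S, \<nu> i) \<in> hedges H \<and> (\<forall>j\<in>S. r j < r i))"
    and g: "g \<in> X" "lab H (\<nu> g) = \<eta>" "\<eta> \<in> sentences L"
    and m: "\<And>i. i \<in> X \<Longrightarrow> length (binary i) \<le> m"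
    and xs: "set xs \<subseteq> X" "distinct xs" "\<And>i. i \<in> X \<Longrightarrow> lab H (\<nu> i) \<in> T \<Longrightarrow> i \<in> set xs"
    and k: "card (X - set xs) \<le> k"
  shows "winnable Q enc \<eta> ts w xs k (2 * n + card (X - set xs) * (3 * n + m + 5))"
  using xs k
proof (induction "card (X - set xs)" arbitrary: xs k)
  case 0
  have fin: "finite X"
    using X(1) finite_subset by blast
  with 0 have "X = set xs"
    by (metis Diff_eq_empty_iff card_0_eq finite_Diff subset_antisym)
  moreover from this have "length xs \<le> n"
    using 0 X(2) by (metis distinct_card)
  ultimately have "winnable Q enc \<eta> ts w xs k (2 * length xs)"
    using winnable_goal[where H = H and \<nu> = \<nu> and L = L, of g xs] g X(1) unfolding Q_def by auto
  then show ?case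
    using \<open>length xs \<le> n\<close> by (elim winnable_mono) simp
next
  case (Suc c)
  have fin: "finite X"
    using X(1) finite_subset by blast
  have "X - set xs \<noteq> {}"
    using Suc(2) by force
  then obtain i where i: "i \<in> X - set xs" "\<And>j. j \<in> X - set xs \<Longrightarrow> r i \<le> r j"
    using ex_has_least_nat[of "\<lambda>i. i \<in> X - set xs" _ r] by blast
  then have "lab H (\<nu> i) \<notin> T"
    using Suc.prems(3)[of i] by auto
  with r[of i] i(1) obtain S where S: "S \<subseteq> X" "(\<nu> ` S, \<nu> i) \<in> hedges H" "\<forall>j\<in>S. r j < r i"
    by auto
  have S_xs: "S \<subseteq> set xs"
  proof
    fix j
    assume "j \<in> S"
    then have "j \<in> X" "r j < r i"
      using S(1,3) by auto
    then show "j \<in> set xs"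
      using i(2)[of j] by auto
  qed
  have diff: "X - set (i # xs) = (X - set xs) - {i}"
    unfolding list.set by (rule Diff_insert)
  have c: "c = card (X - set (i # xs))"
    unfolding diff card_Diff_singleton[OF i(1)] Suc(2)[symmetric] by simp
  obtain k' where k': "k = Suc k'"
    using Suc.prems(4) Suc(2) by (cases k) auto
  have "winnable Q enc \<eta> ts w (i # xs) k' (2 * n + card (X - set (i # xs)) * (3 * n + m + 5))"
    using Suc.prems i(1) Suc(2) c k' by (intro Suc(1)) auto
  moreover have "i \<in> {1..card (verts H)}" "set xs \<subseteq> {1..card (verts H)}"
    using i(1) X(1) Suc.prems(1) by blast+
  ultimately have "winnable Q enc \<eta> ts w xs k (2 * n + card (X - set (i # xs)) * (3 * n + m + 5) +
      (3 * length xs + length (binary i) + 5))"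
    unfolding Q_def k' using S(2) S_xs by (intro winnable_add) blast+
  moreover have "length xs \<le> n"
    using Suc.prems X(2) fin by (metis card_mono distinct_card order_trans)
  moreover have "length (binary i) \<le> m"
    using m i(1) by blast
  ultimately show ?case
    unfolding c[symmetric] Suc(2)[symmetric] by (elim winnable_mono) simp
qed

text \<open>Induction over the part of the theory not yet read; \<open>xs\<close> holds exactly the
  vertices whose label has already been passed. All vertices labelled \<open>t\<close> are added
  while \<open>t\<close> is current, since the theory cannot be reread.\<close>

lemma winnable_grounded:
  fixes L :: "('m, 'a) logic" and enc :: "'a \<Rightarrow> bool list" and H :: "('v, 'a) hypergraph"
    and \<nu> :: "nat \<Rightarrow> 'v" and r :: "nat \<Rightarrow> nat"
  defines "Q \<equiv> access_answer L enc H \<nu>"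
  assumes X: "X \<subseteq> {1..card (verts H)}" "card X \<le> n"
    and r: "\<And>i. i \<in> X \<Longrightarrow> lab H (\<nu> i) \<in> T \<or>
      (\<exists>S\<subseteq>X. (\<nu> ` S, \<nu> i) \<in> hedges H \<and> (\<forall>j\<in>S. r j < r i))"
    and g: "g \<in> X" "lab H (\<nu> g) = \<eta>" "\<eta> \<in> sentences L"
    and m: "\<And>i. i \<in> {1..card (verts H)} \<Longrightarrow> length (binary i) \<le> m"
    and T: "T \<subseteq> sentences L"
    and ts: "set ts \<subseteq> T" "distinct ts"
    and xs: "set xs = {i \<in> X. lab H (\<nu> i) \<in> T - set ts}" "distinct xs"
    and k: "card (X - set xs) \<le> k"
  shows "winnable Q enc \<eta> ts w xs k (2 * length ts + 2 * n + card (X - set xs) * (3 * n + m + 5))"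
  using ts xs k
proof (induction ts arbitrary: xs k w)
  case Nil
  have "winnable Q enc \<eta> [] w xs k (2 * n + card (X - set xs) * (3 * n + m + 5))"
    unfolding Q_def by (rule winnable_edges[OF X r g]) (use Nil X m in auto)
  then show ?case
    by simp
next
  case (Cons t ts)
  have fin: "finite X"
    using X(1) finite_subset by blast
  define A where "A = {i \<in> X. lab H (\<nu> i) = t}"
  obtain as where as: "set as = A" "distinct as"
    using fin finite_distinct_list[of A] unfolding A_def by auto
  have disj: "A \<inter> set xs = {}"
    using Cons.prems(3) by (auto simp: A_def)
  have set_xs: "set (rev as @ xs) = {i \<in> X. lab H (\<nu> i) \<in> T - set ts}"
    using Cons.prems(1-3) by (auto simp: as A_def)
  have dist: "distinct (rev as @ xs)"
    using as disj Cons.prems(4) by auto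
  have "X - set xs = (X - set (rev as @ xs)) \<union> A" "(X - set (rev as @ xs)) \<inter> A = {}"
    using disj by (auto simp: as A_def)
  then have "card (X - set xs) = card (X - set (rev as @ xs)) + card A"
    using fin by (simp add: card_Un_disjoint A_def)
  also have "card A = length as"
    using as by (metis distinct_card)
  finally have card: "card (X - set xs) = card (X - set (rev as @ xs)) + length as" .
  have k: "k - length as + length as = k" "card (X - set (rev as @ xs)) \<le> k - length as"
    using card Cons.prems(5) by auto
  have "length (rev as @ xs) = card (set (rev as @ xs))"
    using dist by (metis distinct_card)
  also have "\<dots> \<le> card X"
    by (rule card_mono[OF fin]) (unfold set_xs, blast)
  finally have len: "length as + length xs \<le> n"
    using X(2) by simp
  have "winnable Q enc \<eta> ts (map Bit (enc t)) (rev as @ xs) (k - length as)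
      (2 * length ts + 2 * n + card (X - set (rev as @ xs)) * (3 * n + m + 5))"
    using Cons.prems(1,2) set_xs dist k(2) by (intro Cons.IH) auto
  then have "winnable Q enc \<eta> ts (map Bit (enc t)) xs (k - length as + length as)
      (2 * length ts + 2 * n + card (X - set (rev as @ xs)) * (3 * n + m + 5) +
       length as * (3 * n + m + 5))"
    unfolding Q_def
    by (rule winnable_add_leaves)
      (use Cons.prems(1,3) T X(1) m len in \<open>auto simp: as A_def\<close>)
  from winnable_next[OF this, of w] show ?case
    unfolding k(1) card by (rule winnable_mono) (simp add: add_mult_distrib)
qed

lemma verifier_complete:
  fixes L :: "('m, 'a) logic" and enc :: "'a \<Rightarrow> bool list" and H :: "('v, 'a) hypergraph"
    and \<nu> :: "nat \<Rightarrow> 'v"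
  defines "Q \<equiv> access_answer L enc H \<nu>"
  assumes X: "grounded T H \<nu> X" "card X \<le> n"
    and g: "g \<in> X" "lab H (\<nu> g) = \<eta>" "\<eta> \<in> sentences L"
    and m: "length (binary (card (verts H))) \<le> m"
    and T: "finite_theory L T" "set ts = T" "distinct ts"
    and w: "w = replicate n (Bit True) @ [Sep] @ map Bit (enc \<eta>) @ [Sep] @ blocks (map enc ts)"
  shows "\<exists>y t s. length y \<le> 2 * length ts + 2 * n + n * (3 * n + m + 5) \<and>
    exec Q verifier (initial w y) t s \<and> accepting s"
proof -
  obtain r :: "nat \<Rightarrow> nat" where r: "\<And>i. i \<in> X \<Longrightarrow> lab H (\<nu> i) \<in> T \<or>
      (\<exists>S\<subseteq>X. (\<nu> ` S, \<nu> i) \<in> hedges H \<and> (\<forall>j\<in>S. r j < r i))"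
    and X_sub: "X \<subseteq> {1..card (verts H)}"
    using X(1) unfolding grounded_def by blast
  have m': "length (binary i) \<le> m" if "i \<in> {1..card (verts H)}" for i
    using that m length_binary_mono[of i "card (verts H)"] by auto
  have "winnable Q enc \<eta> ts [Sep] [] n
      (2 * length ts + 2 * n + card (X - set []) * (3 * n + m + 5))"
    unfolding Q_def
    by (rule winnable_grounded[OF X_sub X(2) r g m'])
      (use T X(2) in \<open>auto simp: finite_theory_def\<close>)
  then obtain y where len: "length y \<le> 2 * length ts + 2 * n + card X * (3 * n + m + 5)"
    and y: "\<And>s. config enc \<eta> ts [Sep] [] n y s \<Longrightarrow> accepts_from Q s"
    unfolding winnable_def by auto
  have "config enc \<eta> ts [Sep] [] n y (ready n (enc \<eta>) (map enc ts) y)"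
    by (auto simp: config_def ready_def intro: exI[of _ "[]"])
  from y[OF this] obtain t1 s where
    "exec Q (Seq main_loop check_goal) (ready n (enc \<eta>) (map enc ts) y) t1 s" "accepting s"
    unfolding accepts_from_def by blast
  moreover obtain t2 where "exec Q prepare (initial w y) t2 (ready n (enc \<eta>) (map enc ts) y)"
    using exec_prepare[OF w, of Q y] by blast
  ultimately have "exec Q verifier (initial w y) (t2 + t1) s"
    unfolding verifier_def by (intro Seq)
  moreover have "card X * (3 * n + m + 5) \<le> n * (3 * n + m + 5)"
    using X(2) by (rule mult_right_mono) simp
  with len have "length y \<le> 2 * length ts + 2 * n + n * (3 * n + m + 5)"
    by linarith
  ultimately show ?thesis
    using \<open>accepting s\<close> by blast
qed

section \<open>Membership in NP\<close>

text \<open>Coefficients of type \<open>nat\<close> cannot be negative.\<close>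

lemma nat_poly_mono: "m \<le> n \<Longrightarrow> poly p m \<le> poly p (n :: nat)"
  by (induction p) (auto intro: add_mono mult_mono)

lemma length_blocks_ge: "length bs \<le> length (blocks bs)"
  by (induction bs) auto

lemma length_le_length_blocks: "b \<in> set bs \<Longrightarrow> length b \<le> length (blocks bs)"
  by (induction bs) auto

text \<open>Index lengths are bounded in logical sizes, certificates in the code length. The code
  has room for at most \<open>N\<close> axioms besides \<open>\<eta>\<close>, and each of these
  sentences has size at most \<open>poly p N\<close>.\<close>

lemma code_size_bound:
  assumes p: "\<forall>\<alpha>\<in>sentences L. sent_size L \<alpha> \<le> poly p (length (enc \<alpha>))"
    and T: "finite_theory L (set ts)" "distinct ts" and \<eta>: "\<eta> \<in> sentences L"
    and N: "length (enc \<eta>) + length (blocks (map enc ts)) \<le> N"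
  shows "theory_size L (set ts) + sent_size L \<eta> \<le> (N + 1) * poly p N"
proof -
  have le: "sent_size L \<alpha> \<le> poly p N" if "\<alpha> \<in> sentences L" "length (enc \<alpha>) \<le> N" for \<alpha>
    using that p nat_poly_mono[of "length (enc \<alpha>)" N p] order_trans by blast
  have "length (enc \<alpha>) \<le> N" if "\<alpha> \<in> set ts" for \<alpha>
    using length_le_length_blocks[of "enc \<alpha>" "map enc ts"] that N by auto
  then have "theory_size L (set ts) \<le> (\<Sum>\<alpha>\<in>set ts. poly p N)"
    unfolding theory_size_def using T(1) by (intro sum_mono le) (auto simp: finite_theory_def)
  also have "\<dots> = length ts * poly p N"
    using T(2) by (simp add: distinct_card)
  also have "\<dots> \<le> N * poly p N"
    using length_blocks_ge[of "map enc ts"] N by (intro mult_right_mono) auto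
  finally show ?thesis
    using le[OF \<eta>] N by simp
qed

theorem theorem10:
  fixes L :: "('m, 'a) logic"
    and enc :: "'a \<Rightarrow> bool list"
    and D :: "('v, 'a) deriver"
    and \<nu> :: "'a set \<Rightarrow> 'a \<Rightarrow> nat \<Rightarrow> 'v"
  assumes "sentence_encoding L enc"
    and "exponential_deriver L D"
    and "vertex_numbering L D \<nu>"
  shows "in_NP (MP_exp_unary L enc D \<nu>)"
proof -
  obtain p :: "nat poly" where inj: "inj_on enc (sentences L)"
    and p: "\<forall>\<alpha>\<in>sentences L. sent_size L \<alpha> \<le> poly p (length (enc \<alpha>))"
    using assms(1) unfolding sentence_encoding_def by blast
  have D: "deriver L D"
    using assms(2) by (simp add: exponential_deriver_def)
  obtain b :: "nat poly" where b: "\<And>T \<eta>. finite_theory L T \<Longrightarrow> \<eta> \<in> targets D \<Longrightarrow>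
      length (binary (card (verts (derive_for D T \<eta>)))) \<le> poly b (theory_size L T + sent_size L \<eta>)"
    using assms(3) unfolding vertex_numbering_def by blast
  \<comment> \<open>The identity polynomial: bounds can then be written with polynomial arithmetic
    and evaluated by simplification.\<close>
  define x :: "nat poly" where "x = [:0, 1:]"
  have x [simp]: "poly x N = N" for N
    by (simp add: x_def)
  \<comment> \<open>The length of an index in terms of the code length, by composing
    \<open>b\<close> with the bound of \<open>code_size_bound\<close>.\<close>
  define m where "m = pcompose b ((x + 1) * p)"
  \<comment> \<open>\<open>4 * x\<close> covers \<open>2 * length ts + 2 * n\<close>, as
    \<open>length ts\<close> and \<open>n\<close> are both at most the code length.\<close>
  define q where "q = 4 * x + x * (3 * x + m + 5)"
  define z where "z = x + q"
  \<comment> \<open>\<open>time_bound\<close> written as a polynomial in \<open>z\<close>, the input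
    length plus the longest allowed certificate.\<close>
  define tb where "tb = z * (12 * (2 * z + (z + 1) * (z + 1) + (2 * z + 3) * (z + 1) + 1) + 7) +
     2 * (2 * z + 3) * (z + 1) + 16 * z + 25"
  have poly_m: "poly m N = poly b ((N + 1) * poly p N)" for N
    by (simp add: m_def poly_pcompose)
  have poly_q: "poly q N = 4 * N + N * (3 * N + poly m N + 5)" for N
    by (simp add: q_def)
  have poly_tb: "poly tb N = time_bound (N + poly q N)" for N
    by (simp add: tb_def z_def time_bound_def)
  have verify: "(\<forall>y. length y \<le> poly q (length w) \<longrightarrow>
      (\<exists>t s. exec Q verifier (initial w y) t s \<and> t \<le> poly tb (length w))) \<and>
    ((\<exists>P :: (nat, 'a) hypergraph. proof_for L T \<eta> P \<and> admissible D T \<eta> P \<and> ct P \<le> n) \<longleftrightarrow>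
      (\<exists>y t s. length y \<le> poly q (length w) \<and> exec Q verifier (initial w y) t s \<and> accepting s))"
    if T: "finite_theory L T" and \<eta>: "\<eta> \<in> targets D"
      and ts: "set ts = T" "distinct ts"
      and w: "w = replicate n (Bit True) @ [Sep] @ map Bit (enc \<eta>) @ [Sep] @ blocks (map enc ts)"
      and Q: "Q = access_answer L enc (derive_for D T \<eta>) (\<nu> T \<eta>)"
    for T \<eta> n ts w Q
  proof -
    let ?H = "derive_for D T \<eta>" and ?\<nu> = "\<nu> T \<eta>"
    have \<eta>': "\<eta> \<in> sentences L" and H: "derivation_structure L T ?H"
      using D T \<eta> by (auto simp: deriver_def)
    have \<nu>: "bij_betw ?\<nu> {1..card (verts ?H)} (verts ?H)"
      using assms(3) T \<eta> by (simp add: vertex_numbering_def)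
    have run: "\<exists>t s. exec Q verifier (initial w y) t s \<and> t \<le> time_bound (length w + length y) \<and>
        (accepting s \<longrightarrow> (\<exists>X g. grounded T ?H ?\<nu> X \<and> g \<in> X \<and> lab ?H (?\<nu> g) = \<eta> \<and> card X \<le> n))" for y
      unfolding Q by (rule exec_verifier[OF inj T \<eta>' w]) (use ts in simp)
    have mono: "time_bound i \<le> time_bound j" if "i \<le> j" for i j
      unfolding time_bound_def by (intro add_mono mult_mono that) simp_all
    have halts: "\<exists>t s. exec Q verifier (initial w y) t s \<and> t \<le> poly tb (length w)"
      if "length y \<le> poly q (length w)" for y
    proof -
      have "time_bound (length w + length y) \<le> poly tb (length w)"
        unfolding poly_tb by (rule mono) (use that in simp)
      with run[of y] show ?thesis
        using order_trans by blast
    qed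
    have sound: "\<exists>P :: (nat, 'a) hypergraph. proof_for L T \<eta> P \<and> admissible D T \<eta> P \<and> ct P \<le> n"
      if "exec Q verifier (initial w y) t s" "accepting s" for y t s
    proof -
      obtain t' s' where s': "exec Q verifier (initial w y) t' s'" "accepting s' \<longrightarrow>
          (\<exists>X g. grounded T ?H ?\<nu> X \<and> g \<in> X \<and> lab ?H (?\<nu> g) = \<eta> \<and> card X \<le> n)"
        using run[of y] by blast
      \<comment> \<open>By determinism, the given accepting run is the one that \<open>run\<close>
        speaks about.\<close>
      have "s = s'"
        using exec_deterministic[OF s'(1) that(1)] by simp
      with s'(2) that(2) obtain X g
        where X: "grounded T ?H ?\<nu> X" "g \<in> X" "lab ?H (?\<nu> g) = \<eta>" "card X \<le> n"
        by blast
      from grounded_imp_proof[OF X(1-3) H \<nu>] X(4) show ?thesis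
        unfolding admissible_def using order_trans by metis
    qed
    have complete: "\<exists>y t s. length y \<le> poly q (length w) \<and>
        exec Q verifier (initial w y) t s \<and> accepting s"
      if P: "proof_for L T \<eta> P" "admissible D T \<eta> P" "ct P \<le> n" for P :: "(nat, 'a) hypergraph"
    proof -
      obtain h where "homomorphism P ?H h"
        using P(2) by (auto simp: admissible_def)
      from proof_imp_grounded[OF P(1) this \<nu>] obtain X g
        where X: "grounded T ?H ?\<nu> X" "g \<in> X" "lab ?H (?\<nu> g) = \<eta>" "card X \<le> ct P"
        by blast
      have len: "n \<le> length w" "length ts \<le> length w"
        using length_blocks_ge[of "map enc ts"] by (simp_all add: w)
      have "theory_size L T + sent_size L \<eta> \<le> (length w + 1) * poly p (length w)"
        using code_size_bound[OF p, of ts \<eta> "length w"] T ts \<eta>' by (simp add: w)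
      then have m: "length (binary (card (verts ?H))) \<le> poly m (length w)"
        unfolding poly_m using b[OF T \<eta>] nat_poly_mono order_trans by blast
      have "card X \<le> n"
        using X(4) P(3) by simp
      from verifier_complete[OF X(1) this X(2,3) \<eta>' m T ts w]
      obtain y t s where y: "exec Q verifier (initial w y) t s" "accepting s"
        and "length y \<le> 2 * length ts + 2 * n + n * (3 * n + poly m (length w) + 5)"
        unfolding Q by blast
      moreover have "n * (3 * n + poly m (length w) + 5) \<le>
          length w * (3 * length w + poly m (length w) + 5)"
        using len by (intro mult_mono) auto
      ultimately have "length y \<le> poly q (length w)"
        unfolding poly_q using len by linarith
      with y show ?thesis
        by blast
    qed
    from halts sound complete show ?thesis
      by blast
  qed
  show ?thesis
    unfolding in_NP_def
  proof (rule exI[of _ verifier], rule exI[of _ tb], rule exI[of _ q], intro ballI)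
    fix i w
    assume i: "i \<in> instances (MP_exp_unary L enc D \<nu>)" and w: "w \<in> codes (MP_exp_unary L enc D \<nu>) i"
    obtain T \<eta> n where Tn: "i = (T, \<eta>, n)"
      by (cases i)
    have "finite_theory L T" "\<eta> \<in> targets D"
      using i by (simp_all add: MP_exp_unary_def Tn)
    moreover obtain ts where "set ts = T" "distinct ts"
      "w = replicate n (Bit True) @ [Sep] @ map Bit (enc \<eta>) @ [Sep] @ blocks (map enc ts)"
      using w by (auto simp: MP_exp_unary_def Tn instance_codes_def blocks_def comp_def)
    ultimately show "(\<forall>y. length y \<le> poly q (length w) \<longrightarrow>
        (\<exists>t s. exec (oracles (MP_exp_unary L enc D \<nu>) i) verifier (initial w y) t s \<and>
          t \<le> poly tb (length w))) \<and>
      (holds (MP_exp_unary L enc D \<nu>) i \<longleftrightarrow>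
        (\<exists>y t s. length y \<le> poly q (length w) \<and>
          exec (oracles (MP_exp_unary L enc D \<nu>) i) verifier (initial w y) t s \<and> accepting s))"
      using verify[of T \<eta> ts w n] by (simp add: MP_exp_unary_def Tn)
  qed
qed

end
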